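(* Let $(X,d,\mu)$ be a PI space. Let $\{(U_j, \phi_j\colon U_j\rightarrow\mathbb{R}^{k_j})\}_{j\in J}$ be a measurable differentiable structure on $X$. Let $\Omega \subset X$ be open, let $\epsilon>0$, and let $\{f_j\colon U_j\cap\Omega \rightarrow \mathbb{R}^{k_j}\}_{j\in J}$ be a collection of Borel functions. Then there is a continuous function $u$ on $X$ that is differentiable almost everywhere and satisfies $$\|u\|_\infty \leq \epsilon \text{ and } \{u\neq 0\}\subset \Omega,$$ $$d^j u = f_j \text{ a.e. in } U_j \cap \Omega$$ for each $j\in J$, and $$\mathrm{Lip}_u = 0 \text{ everywhere in } X\setminus \Omega.$$
   Context: A PI space is a metric measure space $(X,d,\mu)$ with $(X,d)$ complete, $\mu$ a Borel regular doubling measure ($\mu(B(x,2r))\le C\mu(B(x,r))$ for all balls), supporting a $(1,q)$-Poincaré inequality for some $1\le q<\infty$: there is $C>0$ such that for every compactly supported Lipschitz $f\colon X\to\mathbb{R}$ and every open ball $B$, $\frac{1}{\mu(B)}\int_B |f-f_B|\,d\mu \le C(\mathrm{diam}\, B)\left(\frac{1}{\mu(CB)}\int_{CB}(\mathrm{Lip}_f)^q\,d\mu\right)^{1/q}$, where $f_B$ is the average of $f$ over $B$. For a real-valued function $u$ on $X$, $\mathrm{Lip}_u(x)=\limsup_{r\to 0}\frac1r\sup_{d(x,y)<r}|u(y)-u(x)|$. A measurable differentiable structure on $X$ is a collection $\{(U_j,\phi_j)\}_{j\in J}$ of pairwise disjoint measurable sets $U_j$ covering $X$ and Lipschitz functions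 $\phi_j$ into $\mathbb{R}^{k_j}$ ($k_j\ge 0$ integers) such that for every Lipschitz $u$ on $X$ and every $j$ there is a Borel function $d^ju\colon U_j\to\mathbb{R}^{k_j}$, unique up to null sets, with $\lim_{y\to x}\frac{|u(y)-u(x)-\langle d^ju(x),\phi_j(y)-\phi_j(x)\rangle|}{d(y,x)}=0$ for a.e. $x\in U_j$. A function $u$ is said to be differentiable at $x\in U_j$ with derivative $d^ju(x)$ if this limit is zero at $x$, i.e. $\mathrm{Lip}_{u-\langle d^ju(x),\phi_j\rangle}(x)=0$. By Cheeger's theorem every PI space supports such a structure. *)

theory Defs
  imports "HOL-Analysis.Analysis"
begin

text \<open>The metric space X is the whole type 'a (class complete_space gives
completeness); the measure M lives on the Borel sets of 'a.
Vectors in R^k are represented as functions nat => real of which only the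
coordinates i < k are relevant.\<close>

definition Lip :: "('a::metric_space \<Rightarrow> real) \<Rightarrow> 'a \<Rightarrow> ereal" where
  "Lip u x = Limsup (at_right 0)
      (\<lambda>r::real. (SUP y\<in>ball x r. ereal (\<bar>u y - u x\<bar> / r)))"

definition doubling :: "'a::metric_space measure \<Rightarrow> bool" where
  "doubling M \<longleftrightarrow>
     (\<forall>x r. r > 0 \<longrightarrow> 0 < emeasure M (ball x r) \<and> emeasure M (ball x r) < \<infinity>) \<and>
     (\<exists>Cd. \<forall>x r. r > 0 \<longrightarrow> emeasure M (ball x (2 * r)) \<le> ennreal Cd * emeasure M (ball x r))"

definition average_on :: "'a measure \<Rightarrow> 'a set \<Rightarrow> ('a \<Rightarrow> real) \<Rightarrow> real" where
  "average_on M B g = (1 / measure M B) * (LINT y:B|M. g y)"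

definition poincare_1q :: "'a::metric_space measure \<Rightarrow> real \<Rightarrow> real \<Rightarrow> bool" where
  "poincare_1q M q C \<longleftrightarrow>
     (\<forall>f::'a \<Rightarrow> real. (\<exists>L. L-lipschitz_on UNIV f) \<and> compact (closure {y. f y \<noteq> 0}) \<longrightarrow>
       (\<forall>x r. r > 0 \<longrightarrow>
          average_on M (ball x r) (\<lambda>y. \<bar>f y - average_on M (ball x r) f\<bar>)
          \<le> C * diameter (ball x r) *
            (average_on M (ball x (C * r)) (\<lambda>y. real_of_ereal (Lip f y) powr q)) powr (1 / q)))"

definition PI_space :: "'a::complete_space measure \<Rightarrow> bool" where
  "PI_space M \<longleftrightarrow> sets M = sets borel \<and> doubling M \<and>
     (\<exists>q C. 1 \<le> q \<and> C > 0 \<and> poincare_1q M q C)"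

definition eucl_dist :: "nat \<Rightarrow> (nat \<Rightarrow> real) \<Rightarrow> (nat \<Rightarrow> real) \<Rightarrow> real" where
  "eucl_dist n v w = sqrt (\<Sum>i<n. (v i - w i)^2)"

definition vinner :: "nat \<Rightarrow> (nat \<Rightarrow> real) \<Rightarrow> (nat \<Rightarrow> real) \<Rightarrow> real" where
  "vinner n v w = (\<Sum>i<n. v i * w i)"

definition chart_differentiable ::
  "('a::metric_space \<Rightarrow> nat \<Rightarrow> real) \<Rightarrow> nat \<Rightarrow> ('a \<Rightarrow> real) \<Rightarrow> 'a \<Rightarrow> (nat \<Rightarrow> real) \<Rightarrow> bool" where
  "chart_differentiable \<phi> n u x v \<longleftrightarrow> Lip (\<lambda>y. u y - vinner n v (\<phi> y)) x = 0"

definition borel_on :: "'a::topological_space set \<Rightarrow> nat \<Rightarrow> ('a \<Rightarrow> nat \<Rightarrow> real) \<Rightarrow> bool" where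
  "borel_on S n g \<longleftrightarrow> (\<forall>i<n. (\<lambda>x. g x i) \<in> borel_measurable (restrict_space borel S))"

definition meas_diff_structure ::
  "'a::metric_space measure \<Rightarrow> 'j set \<Rightarrow> ('j \<Rightarrow> 'a set) \<Rightarrow> ('j \<Rightarrow> nat)
     \<Rightarrow> ('j \<Rightarrow> 'a \<Rightarrow> nat \<Rightarrow> real) \<Rightarrow> bool" where
  "meas_diff_structure M J U k \<phi> \<longleftrightarrow>
     (\<forall>j\<in>J. U j \<in> sets (completion M)) \<and>
     disjoint_family_on U J \<and>
     (\<Union>j\<in>J. U j) = UNIV \<and>
     (\<forall>j\<in>J. \<exists>L. \<forall>x y. eucl_dist (k j) (\<phi> j x) (\<phi> j y) \<le> L * dist x y) \<and>
     (\<forall>u::'a \<Rightarrow> real. (\<exists>L. L-lipschitz_on UNIV u) \<longrightarrow>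
        (\<forall>j\<in>J. \<exists>du. borel_on (U j) (k j) du \<and>
             (AE x in M. x \<in> U j \<longrightarrow> chart_differentiable (\<phi> j) (k j) u x (du x)) \<and>
             (\<forall>du'. borel_on (U j) (k j) du' \<and>
                 (AE x in M. x \<in> U j \<longrightarrow> chart_differentiable (\<phi> j) (k j) u x (du' x)) \<longrightarrow>
                 (AE x in M. x \<in> U j \<longrightarrow> (\<forall>i<k j. du x i = du' x i)))))"

end

theory Submission
  imports Defs
begin

text \<open>
The measure may be replaced by a finite measure with the same null sets. Approximating \<open>f\<close> by functions with countably many values gives,
at each scale \<open>n\<close>, a countable Borel partition together with a Lipschitz function \<open>h\<^sub>n\<close> on each
piece (a fixed linear combination of chart coordinates), such that at every point the two functions
chosen at the scales \<open>n\<close> and \<open>n + 1\<close> differ by a function with Lipschitz constant of order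
\<open>4 ^ (- n)\<close>.

Given \<open>S\<^sub>n\<close>, which agrees locally with \<open>h\<^sub>n\<close> up to a constant around every point of a good set
\<open>G\<^sub>n\<close>, one adds a tiny sawtooth function of \<open>h\<^bsub>n+1\<^esub> - S\<^sub>n\<close> on every piece. The sawtooth rises with
slope one and falls steeply, with slope of order \<open>2 ^ n\<close>; on the rising part the sum \<open>S\<^bsub>n+1\<^esub>\<close> is
\<open>h\<^bsub>n+1\<^esub>\<close> plus a constant, and by the pigeonhole principle some phase of the sawtooth makes the
falling part have measure of order \<open>2 ^ (- n)\<close>. The increments are small in the supremum norm and, at
points of \<open>G\<^sub>n \<inter> G\<^bsub>n+1\<^esub>\<close>, have pointwise slope at most \<open>2 ^ (- n)\<close>; by Borel-Cantelli almost every
point of \<open>\<Omega>\<close> lies in all but finitely many \<open>G\<^sub>n\<close>, and there the limit has the prescribed differential.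
\<close>

section \<open>A criterion for the vanishing of \<open>Lip\<close>\<close>

text \<open>Points of \<open>ball x r\<close> have \<open>dist x y < r\<close>, so the suprema are
  at most \<open>e\<close> for small \<open>r\<close>; the choice \<open>y = x\<close> shows that
  they are nonnegative.\<close>

lemma Lip_eq_0I:
  assumes "\<And>e. e > 0 \<Longrightarrow> \<exists>r>0. \<forall>y. dist x y < r \<longrightarrow> \<bar>u y - u x\<bar> \<le> e * dist x y"
  shows "Lip u x = 0"
proof -
  define g where "g r = (SUP y\<in>ball x r. ereal (\<bar>u y - u x\<bar> / r))" for r :: real
  have g0: "0 \<le> g r" if "r > 0" for r
    unfolding g_def using that by (intro SUP_upper2[of x]) auto
  have ev: "eventually (\<lambda>r. g r \<le> ereal e) (at_right 0)" if e: "e > 0" for e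
  proof -
    obtain r0 where r0: "r0 > 0" "\<And>y. dist x y < r0 \<Longrightarrow> \<bar>u y - u x\<bar> \<le> e * dist x y"
      using assms[OF e] by blast
    have "g r \<le> ereal e" if "0 < r" "r < r0" for r
      unfolding g_def
    proof (rule SUP_least)
      fix y assume "y \<in> ball x r"
      then have d: "dist x y < r" by simp
      with r0(2)[of y] that have "\<bar>u y - u x\<bar> \<le> e * dist x y" by simp
      also have "\<dots> \<le> e * r" using d e by simp
      finally show "ereal (\<bar>u y - u x\<bar> / r) \<le> ereal e" using that by (simp add: field_simps)
    qed
    then show ?thesis unfolding eventually_at_right_field using r0(1) by blast
  qed
  have "Limsup (at_right 0) g \<le> ereal e" if "e > 0" for e
    using ev[OF that] by (rule Limsup_bounded)
  then have "Limsup (at_right 0) g \<le> 0"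
    by (metis add_0 ereal_le_epsilon2 zero_ereal_def)
  moreover have "0 \<le> Limsup (at_right 0) g"
    by (rule le_Limsup) (auto simp: eventually_at_right_field intro!: g0 exI[of _ 1])
  ultimately show ?thesis unfolding Lip_def g_def by (simp add: antisym)
qed

section \<open>The sawtooth function and cutoffs\<close>

text \<open>The \<open>N\<close>-periodic sawtooth that rises with slope 1 on \<open>[0, N - 1/2]\<close> and falls back to 0 on
\<open>[N - 1/2, N]\<close>.\<close>

definition saw :: "nat \<Rightarrow> real \<Rightarrow> real" where
  "saw N t = (let s = t - real N * of_int \<lfloor>t / real N\<rfloor>
              in min s ((2 * real N - 1) * (real N - s)))"

text \<open>The right end of the period may be included: there the floor jumps to
  \<open>z + 1\<close>, but the falling piece of the old period and the rising piece of the new one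
  both give 0.\<close>

lemma saw_period:
  assumes "N > 0" "real N * of_int z \<le> t" "t \<le> real N * (of_int z + 1)"
  shows "saw N t = min (t - real N * of_int z) ((2 * real N - 1) * (real N * (of_int z + 1) - t))"
proof (cases "t = real N * (of_int z + 1)")
  case True
  then have "t / real N = of_int (z + 1)" using assms(1) by simp
  then have "\<lfloor>t / real N\<rfloor> = z + 1" by (simp only: floor_of_int)
  then show ?thesis using True assms(1) by (simp add: saw_def Let_def)
next
  case False
  with assms have "of_int z \<le> t / real N" "t / real N < of_int z + 1"
    by (auto simp: field_simps)
  then have "\<lfloor>t / real N\<rfloor> = z" by (simp add: floor_eq_iff)
  then show ?thesis by (simp add: saw_def algebra_simps)
qed

lemma floor_div_period:
  assumes "N > 0"
  shows "real N * of_int \<lfloor>t / real N\<rfloor> \<le> t" "t < real N * (of_int \<lfloor>t / real N\<rfloor> + 1)"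
proof -
  have N: "0 < real N" using assms by simp
  have "of_int \<lfloor>t / real N\<rfloor> \<le> t / real N" "t / real N < of_int \<lfloor>t / real N\<rfloor> + 1"
    by linarith+
  then show "real N * of_int \<lfloor>t / real N\<rfloor> \<le> t" "t < real N * (of_int \<lfloor>t / real N\<rfloor> + 1)"
    unfolding pos_le_divide_eq[OF N] pos_divide_less_eq[OF N] by (simp_all add: mult.commute)
qed

lemma saw_bounds:
  assumes "N > 0"
  shows "0 \<le> saw N t" "saw N t \<le> real N"
proof -
  note p = floor_div_period[OF assms, of t]
  have N: "real N \<ge> 1" using assms by simp
  have "saw N t = min (t - real N * of_int \<lfloor>t / real N\<rfloor>) ((2 * real N - 1) * (real N * (of_int \<lfloor>t / real N\<rfloor> + 1) - t))"
    by (rule saw_period) (use p assms in auto)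
  moreover have "0 \<le> (2 * real N - 1) * (real N * (of_int \<lfloor>t / real N\<rfloor> + 1) - t)"
    using p N by (intro mult_nonneg_nonneg) auto
  ultimately show "0 \<le> saw N t" "saw N t \<le> real N"
    using p by (auto simp: algebra_simps min_le_iff_disj)
qed

text \<open>Within a period \<open>saw\<close> is a minimum of two functions of slopes 1 and
  \<open>- K\<close>. Across periods both values are controlled by the distance to a zero between
  \<open>s\<close> and \<open>t\<close>, and being nonnegative they differ by at most the larger
  one.\<close>

lemma saw_lipschitz_le:
  assumes "N > 0" "s \<le> t"
  shows "\<bar>saw N s - saw N t\<bar> \<le> 2 * real N * (t - s)"
proof -
  define a where "a = \<lfloor>s / real N\<rfloor>"
  define b where "b = \<lfloor>t / real N\<rfloor>"
  define K where "K = 2 * real N - 1"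
  have K: "K \<ge> 1" "K \<le> 2 * real N" using assms by (auto simp: K_def)
  note pa = floor_div_period[OF assms(1), of s, folded a_def]
  note pb = floor_div_period[OF assms(1), of t, folded b_def]
  have sa: "saw N s = min (s - real N * of_int a) (K * (real N * (of_int a + 1) - s))"
    unfolding K_def by (rule saw_period) (use pa assms in auto)
  have sb: "saw N t = min (t - real N * of_int b) (K * (real N * (of_int b + 1) - t))"
    unfolding K_def by (rule saw_period) (use pb assms in auto)
  have st: "t - s \<le> K * (t - s)" using K assms mult_right_mono[of 1 K "t - s"] by simp
  have "\<bar>saw N s - saw N t\<bar> \<le> K * (t - s)"
  proof (cases "a = b")
    case True
    have "K * (real N * (of_int a + 1) - s) - K * (real N * (of_int b + 1) - t) = K * (t - s)"
      using True by (simp add: algebra_simps)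
    then show ?thesis using sa sb st True assms(2) unfolding min_def by (auto split: if_splits)
  next
    case False
    have "a \<le> b" unfolding a_def b_def using assms by (intro floor_mono) (simp add: divide_right_mono)
    with False have "of_int a + 1 \<le> (of_int b :: real)" by linarith
    then have "real N * (of_int a + 1) \<le> real N * of_int b" by (intro mult_left_mono) auto
    then have d: "real N * (of_int a + 1) - s \<le> t - s" "t - real N * of_int b \<le> t - s"
      using pa pb by auto
    have "saw N s \<le> K * (real N * (of_int a + 1) - s)" using sa by simp
    also have "\<dots> \<le> K * (t - s)" using d K by (intro mult_left_mono) auto
    finally have 1: "saw N s \<le> K * (t - s)" .
    have 2: "saw N t \<le> K * (t - s)" using sb d st by simp
    from 1 2 show ?thesis using saw_bounds(1)[OF assms(1), of s] saw_bounds(1)[OF assms(1), of t] by linarith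
  qed
  also have "\<dots> \<le> 2 * real N * (t - s)" using K assms by (intro mult_right_mono) auto
  finally show ?thesis .
qed

lemma saw_lipschitz:
  assumes "N > 0"
  shows "\<bar>saw N s - saw N t\<bar> \<le> 2 * real N * \<bar>s - t\<bar>"
  using saw_lipschitz_le[OF assms, of s t] saw_lipschitz_le[OF assms, of t s]
  by (cases "s \<le> t") (auto simp: abs_minus_commute)

lemma continuous_saw:
  assumes "N > 0"
  shows "continuous_on UNIV (saw N)"
proof -
  have "(2 * real N)-lipschitz_on UNIV (saw N)"
    by (rule lipschitz_onI) (use saw_lipschitz[OF assms] in \<open>auto simp: dist_real_def\<close>)
  then show ?thesis by (rule lipschitz_on_continuous_on)
qed

text \<open>For \<open>a\<close> a multiple of \<open>N\<close>, the points with
  \<open>int N dvd \<lceil>t\<rceil>\<close> fill the last unit \<open>(a + N - 1, a + N]\<close> of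
  the period, which contains the fall and a margin of 1/2 before it. Every other point lies strictly
  after a zero and on the rising part.\<close>

lemma saw_locally_translation:
  assumes N: "N > 0" and t: "\<not> int N dvd \<lceil>t\<rceil>"
  shows "\<exists>d>0. \<forall>s. \<bar>s - t\<bar> < d \<longrightarrow> saw N s - s = saw N t - t"
proof -
  define z where "z = \<lfloor>t / real N\<rfloor>"
  note p = floor_div_period[OF N, of t, folded z_def]
  define a where "a = real N * of_int z"
  have az: "a = of_int (int N * z)" by (simp add: a_def)
  have a1: "a \<noteq> t" using t az by (metis ceiling_of_int dvd_triv_left)
  have a2: "t \<le> a + real N - 1"
  proof (rule ccontr)
    assume "\<not> ?thesis"
    then have "\<lceil>t\<rceil> = int N * (z + 1)"
      using p az unfolding ceiling_eq_iff by (auto simp: algebra_simps)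
    then show False using t by simp
  qed
  \<comment> \<open>\<open>1/2\<close> is the distance from \<open>a + N - 1\<close> to the start of
    the fall, \<open>t - a\<close> the distance back to the preceding zero.\<close>
  define d where "d = min (1/2) (t - a)"
  have d: "d > 0" using a1 p by (auto simp: d_def a_def)
  have "saw N s - s = - a" if "\<bar>s - t\<bar> < d" for s
  proof -
    have s: "a \<le> s" "s \<le> a + real N - 1/2" using that a2 unfolding d_def by linarith+
    have "saw N s = min (s - real N * of_int z) ((2 * real N - 1) * (real N * (of_int z + 1) - s))"
      by (rule saw_period) (use s N in \<open>auto simp: a_def algebra_simps\<close>)
    moreover have "real N - 1/2 \<le> (2 * real N - 1) * (1/2)" by simp
    moreover have "(2 * real N - 1) * (1/2) \<le> (2 * real N - 1) * (real N * (of_int z + 1) - s)"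
      using s N by (intro mult_left_mono) (auto simp: a_def algebra_simps)
    ultimately show ?thesis using s by (auto simp: a_def)
  qed
  with d show ?thesis by (metis abs_zero cancel_comm_monoid_add_class.diff_cancel)
qed

text \<open>A clamped affine function of the distance to \<open>K\<close> that drops from 1 to 0
  between the distances \<open>\<delta> / 4\<close> and \<open>\<delta> / 2\<close>.\<close>

lemma cutoff_near_set:
  fixes K :: "'a::metric_space set"
  assumes "\<delta> > 0"
  shows "\<exists>\<psi>::'a \<Rightarrow> real. continuous_on UNIV \<psi> \<and> (\<forall>y. 0 \<le> \<psi> y \<and> \<psi> y \<le> 1) \<and>
           (\<forall>x\<in>K. \<forall>y. dist x y < \<delta> / 4 \<longrightarrow> \<psi> y = 1) \<and>
           (\<forall>y. \<psi> y \<noteq> 0 \<longrightarrow> (\<exists>x\<in>K. dist x y < \<delta> / 2))"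
\<comment> \<open>\<open>infdist y {}\<close> is 0 by convention, so the formula would give the
  constant 1 for empty \<open>K\<close>.\<close>
proof (cases "K = {}")
  case True
  then show ?thesis by (intro exI[of _ "\<lambda>_. 0"]) auto
next
  case False
  define \<psi> where "\<psi> y = max 0 (min 1 (2 - 4 * infdist y K / \<delta>))" for y
  have "continuous_on UNIV \<psi>" unfolding \<psi>_def by (intro continuous_intros) (use assms in auto)
  moreover have "\<psi> y = 1" if "x \<in> K" "dist x y < \<delta> / 4" for x y
  proof -
    have "infdist y K \<le> dist y x" by (rule infdist_le[OF that(1)])
    also have "\<dots> < \<delta> / 4" using that by (simp add: dist_commute)
    finally show ?thesis using assms by (simp add: \<psi>_def field_simps)
  qed
  moreover have "\<exists>x\<in>K. dist x y < \<delta> / 2" if "\<psi> y \<noteq> 0" for y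
  proof -
    have "infdist y K < \<delta> / 2"
      using that assms by (auto simp: \<psi>_def field_simps max_def min_def split: if_splits)
    then have "\<exists>x\<in>K. dist y x < \<delta> / 2"
      using False cINF_less_iff[of K "dist y" "\<delta> / 2"] by (simp add: infdist_def)
    then show ?thesis by (simp add: dist_commute)
  qed
  ultimately show ?thesis by (intro exI[of _ \<psi>]) (auto simp: \<psi>_def)
qed

section \<open>Finite Borel measures on metric spaces: regularity, uniform radii, separated
  pieces\<close>

locale finite_borel_measure_on_metric = finite_measure M
  for M :: "'a::metric_space measure" +
  assumes sets_eq_borel: "sets M = sets borel"
begin

lemma space_eq_UNIV [simp]: "space M = UNIV"
  using sets_eq_imp_space_eq[OF sets_eq_borel] by simp

lemma open_sets: "open A \<Longrightarrow> A \<in> sets M"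
  and closed_sets: "closed A \<Longrightarrow> A \<in> sets M"
  by (simp_all add: sets_eq_borel)

text \<open>An Egorov-type argument: the sets where the radius \<open>1 / Suc n\<close> fails
  decrease to the empty set, so one of them has small measure. It turns a radius depending on the
  point into a common one off a small set.\<close>

lemma uniform_radius:
  fixes P :: "'a \<Rightarrow> real \<Rightarrow> bool"
  assumes G: "\<And>r. {x \<in> G. P x r} \<in> sets M" "G \<in> sets M"
    and anti: "\<And>x r s. P x r \<Longrightarrow> s \<le> r \<Longrightarrow> P x s"
    and ex: "\<And>x. x \<in> G \<Longrightarrow> \<exists>r>0. P x r" and e: "e > 0"
  shows "\<exists>r>0. measure M (G - {x \<in> G. P x r}) < e"
proof -
  define D where "D n = G - {x \<in> G. P x (1 / real (Suc n))}" for n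
  have D: "range D \<subseteq> sets M" using G unfolding D_def by auto
  have dec: "decseq D"
    unfolding D_def decseq_def using anti by (auto simp: field_simps)
  have "(\<Inter>n. D n) = {}"
  proof (safe, simp)
    fix x assume "\<forall>n. x \<in> D n"
    then have x: "x \<in> G" "\<And>n. \<not> P x (1 / real (Suc n))" by (auto simp: D_def)
    then obtain r where r: "r > 0" "P x r" using ex by blast
    then obtain n where "1 / real (Suc n) < r" using nat_approx_posE by blast
    with anti[OF r(2), of "1 / real (Suc n)"] x show False by simp
  qed
  with finite_Lim_measure_decseq[OF D dec] have "(\<lambda>n. measure M (D n)) \<longlonglongrightarrow> 0" by simp
  then have "\<forall>\<^sub>F n in sequentially. measure M (D n) < e" using e by (rule order_tendstoD)
  then obtain n where "measure M (D n) < e" by (auto simp: eventually_sequentially)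
  then show ?thesis unfolding D_def by (intro exI[of _ "1 / real (Suc n)"]) auto
qed

text \<open>Regularity, by induction over the sigma-algebra generated by the closed sets. Inner and
  outer approximation are carried together because complements exchange them.\<close>

lemma closed_open_approx:
  assumes "A \<in> sets borel" "e > 0"
  shows "\<exists>C V. closed C \<and> open V \<and> C \<subseteq> A \<and> A \<subseteq> V \<and> measure M (V - C) < e"
proof -
  have "A \<in> sigma_sets UNIV {S. closed S}"
    using assms(1) by (simp add: borel_eq_closed)
  then have "\<forall>e>0. \<exists>C V. closed C \<and> open V \<and> C \<subseteq> A \<and> A \<subseteq> V \<and> measure M (V - C) < e"
  proof induction
    case (Basic F)
    then have F: "closed F" by simp
    show ?case
    proof (intro allI impI)
      fix e :: real assume e: "e > 0"
      \<comment> \<open>The neighbourhoods of radius \<open>1 / Suc n\<close> of a closed set shrink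
        to the set itself, so their excess \<open>D n\<close> tends to measure 0.\<close>
      define D where "D n = (\<Union>x\<in>F. ball x (1 / real (Suc n))) - F" for n
      have "D n \<in> sets M" for n unfolding D_def
        by (rule sets.Diff[OF open_sets closed_sets]) (use F in auto)
      then have D: "range D \<subseteq> sets M" by auto
      have dec: "decseq D"
      proof (unfold decseq_def, intro allI impI subsetI)
        fix m n x assume mn: "(m::nat) \<le> n" and x: "x \<in> D n"
        then obtain y where y: "y \<in> F" "dist y x < 1 / real (Suc n)" "x \<notin> F"
          by (auto simp: D_def)
        moreover have "1 / real (Suc n) \<le> 1 / real (Suc m)" using mn by (simp add: field_simps)
        ultimately show "x \<in> D m" by (force simp: D_def)
      qed
      have "(\<Inter>n. D n) = {}"
      proof (rule ccontr)
        assume "(\<Inter>n. D n) \<noteq> {}"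
        then obtain x where x: "\<And>n. x \<in> D n" by blast
        then have "x \<notin> F" by (auto simp: D_def)
        then obtain d where d: "d > 0" "ball x d \<subseteq> - F"
          using openE[OF open_Compl[OF F], of x] by blast
        then obtain n where "1 / real (Suc n) < d" using nat_approx_posE by blast
        moreover obtain y where "y \<in> F" "dist y x < 1 / real (Suc n)"
          using x[of n] by (auto simp: D_def)
        ultimately have "dist x y < d" by (metis dist_commute order.strict_trans)
        then have "y \<in> - F" by (intro subsetD[OF d(2)]) simp
        with \<open>y \<in> F\<close> show False by simp
      qed
      with finite_Lim_measure_decseq[OF D dec] have "(\<lambda>n. measure M (D n)) \<longlonglongrightarrow> 0" by simp
      then have "\<forall>\<^sub>F n in sequentially. measure M (D n) < e" using e by (rule order_tendstoD)
      then obtain n where "measure M (D n) < e" by (auto simp: eventually_sequentially)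
      then show "\<exists>C V. closed C \<and> open V \<and> C \<subseteq> F \<and> F \<subseteq> V \<and> measure M (V - C) < e"
        using F unfolding D_def
        by (intro exI[of _ F] exI[of _ "\<Union>x\<in>F. ball x (1 / real (Suc n))"]) force
    qed
  next
    case Empty
    show ?case by (intro allI impI exI[of _ "{}::'a set"] conjI) auto
  next
    case (Compl F)
    show ?case
    proof (intro allI impI)
      fix e :: real assume e: "e > 0"
      obtain C V where "closed C" "open V" "C \<subseteq> F" "F \<subseteq> V" "measure M (V - C) < e"
        using Compl.IH[rule_format, OF e] by (elim exE conjE)
      moreover have "- C - - V = V - C" by blast
      ultimately show "\<exists>C V. closed C \<and> open V \<and> C \<subseteq> UNIV - F \<and> UNIV - F \<subseteq> V \<and> measure M (V - C) < e"
        by (intro exI[of _ "- V"] exI[of _ "- C"]) auto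
    qed
  next
    case (Union F)
    show ?case
    proof (intro allI impI)
      fix e :: real assume e: "e > 0"
      \<comment> \<open>These errors sum to \<open>e / 2\<close>; the other half pays for truncating
        the union of the \<open>C i\<close>.\<close>
      have "\<forall>i. \<exists>C V. closed C \<and> open V \<and> C \<subseteq> F i \<and> F i \<subseteq> V \<and> measure M (V - C) < e / 4 * (1/2)^i"
        by (intro allI Union.IH[rule_format]) (use e in simp)
      then obtain C V where CV: "\<And>i. closed (C i)" "\<And>i. open (V i)" "\<And>i. C i \<subseteq> F i"
        "\<And>i. F i \<subseteq> V i" "\<And>i. measure M (V i - C i) < e / 4 * (1/2)^i"
        by metis
      have sums: "(\<lambda>i. e / 4 * (1/2)^i) sums (e / 4 * 2)"
        using geometric_sums[of "1/2::real"] by (intro sums_mult) simp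
      have summ: "summable (\<lambda>i. measure M (V i - C i))"
        by (rule summable_comparison_test'[OF sums_summable[OF sums], of 0])
          (use CV(5) in \<open>auto intro: less_imp_le\<close>)
      have VC: "V i - C i \<in> sets M" for i using CV by (auto intro: sets.Diff open_sets closed_sets)
      have 1: "measure M (\<Union>i. V i - C i) \<le> e / 2"
      proof -
        have "measure M (\<Union>i. V i - C i) \<le> (\<Sum>i. measure M (V i - C i))"
          using VC summ by (intro finite_measure_subadditive_countably) auto
        also have "\<dots> \<le> (\<Sum>i. e / 4 * (1/2)^i)"
          using CV(5) by (intro suminf_le summ sums_summable[OF sums]) (auto intro: less_imp_le)
        also have "\<dots> = e / 2" using sums_unique[OF sums] by simp
        finally show ?thesis .
      qed
      \<comment> \<open>An infinite union of closed sets need not be closed, so only finitely many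
        \<open>C i\<close> are kept; \<open>D n\<close> is what is lost.\<close>
      define D where "D n = (\<Union>i. C i) - (\<Union>i\<le>n. C i)" for n
      have "C i \<in> sets M" for i using CV(1) by (rule closed_sets)
      then have D: "range D \<subseteq> sets M" unfolding D_def by auto
      have dec: "decseq D" unfolding D_def decseq_def by force
      have "(\<Inter>n. D n) = {}" unfolding D_def by blast
      with finite_Lim_measure_decseq[OF D dec] have "(\<lambda>n. measure M (D n)) \<longlonglongrightarrow> 0" by simp
      then have "\<forall>\<^sub>F n in sequentially. measure M (D n) < e / 2"
        using e by (intro order_tendstoD) auto
      then obtain n where n: "measure M (D n) < e / 2" by (auto simp: eventually_sequentially)
      have "measure M ((\<Union>i. V i) - (\<Union>i\<le>n. C i)) \<le> measure M ((\<Union>i. V i - C i) \<union> D n)"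
        using VC D by (intro finite_measure_mono) (auto simp: D_def)
      also have "\<dots> \<le> measure M (\<Union>i. V i - C i) + measure M (D n)"
        using VC D by (intro measure_Un_le) auto
      also have "\<dots> < e" using 1 n by simp
      finally have lt: "measure M ((\<Union>i. V i) - (\<Union>i\<le>n. C i)) < e" .
      have "closed (\<Union>i\<le>n. C i)" "open (\<Union>i. V i)" using CV by auto
      moreover have "(\<Union>i\<le>n. C i) \<subseteq> (\<Union>i. F i)" "(\<Union>i. F i) \<subseteq> (\<Union>i. V i)"
        using CV(3,4) by (meson UN_least UN_upper order_trans UNIV_I, meson UN_mono CV(4) order_refl)
      ultimately show "\<exists>C V. closed C \<and> open V \<and> C \<subseteq> \<Union> (range F) \<and> \<Union> (range F) \<subseteq> V \<and> measure M (V - C) < e"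
        using lt by (intro exI[of _ "\<Union>i\<le>n. C i"] exI[of _ "\<Union>i. V i"] conjI)
    qed
  qed
  then show ?thesis using assms(2) by blast
qed

lemma inner_closed_approx:
  assumes "A \<in> sets M" "e > 0"
  shows "\<exists>C. closed C \<and> C \<subseteq> A \<and> measure M (A - C) < e"
proof -
  obtain C V where C: "closed C" "open V" "C \<subseteq> A" "A \<subseteq> V" "measure M (V - C) < e"
    using closed_open_approx[of A e] assms by (auto simp: sets_eq_borel)
  moreover have "measure M (A - C) \<le> measure M (V - C)"
    using C assms by (intro finite_measure_mono) (auto intro: open_sets closed_sets)
  ultimately show ?thesis by (intro exI[of _ C]) auto
qed

lemma exists_small_of_disjoint:
  assumes "N > 0" "disjoint_family_on B {..<N}" "\<And>j. j < N \<Longrightarrow> B j \<in> sets M"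
  shows "\<exists>j<N. real N * measure M (B j) \<le> measure M UNIV"
proof (rule ccontr)
  assume "\<not> ?thesis"
  then have "\<And>j. j < N \<Longrightarrow> measure M UNIV / real N < measure M (B j)"
    using assms(1) by (auto simp: field_simps not_le)
  then have "(\<Sum>j<N. measure M UNIV / real N) < (\<Sum>j<N. measure M (B j))"
    using assms(1) by (intro sum_strict_mono) auto
  also have "\<dots> = measure M (\<Union>j<N. B j)"
    using assms by (intro finite_measure_finite_Union[symmetric]) auto
  also have "\<dots> \<le> measure M UNIV"
    using finite_measure_mono[of "\<Union>j<N. B j" UNIV] sets.top[of M] by simp
  finally show False using assms(1) by simp
qed

text \<open>The condition ranges over uncountably many \<open>y\<close>; closedness gives the
  measurability that \<open>uniform_radius\<close> asks for. The strict inequality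
  \<open>dist x y < r\<close> survives a small move of the centre.\<close>

lemma closed_const_on_balls:
  fixes d :: "'a \<Rightarrow> real"
  assumes "continuous_on UNIV d"
  shows "closed {x. \<forall>y. dist x y < r \<longrightarrow> d y = d x}"
proof (subst closed_sequential_limits, safe)
  fix s l y
  assume s: "\<forall>n. s n \<in> {x. \<forall>y. dist x y < r \<longrightarrow> d y = d x}" "s \<longlonglongrightarrow> l" and y: "dist l y < r"
  have "(\<lambda>n. dist (s n) y) \<longlonglongrightarrow> dist l y" using s(2) by (intro tendsto_intros)
  then have "\<forall>\<^sub>F n in sequentially. dist (s n) y < r" using y by (rule order_tendstoD)
  then have "\<forall>\<^sub>F n in sequentially. d (s n) = d y" by eventually_elim (use s in auto)
  then have "(\<lambda>n. d (s n)) \<longlonglongrightarrow> d y" by (rule tendsto_eventually)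
  moreover have "(\<lambda>n. d (s n)) \<longlonglongrightarrow> d l"
    using assms s(2) by (auto simp: continuous_on_eq_continuous_at continuous_at_sequentially comp_def)
  ultimately show "d y = d l" using LIMSEQ_unique by blast
qed

lemma finitely_many_indices:
  assumes idx: "idx \<in> M \<rightarrow>\<^sub>M count_space UNIV" and "e > 0"
  shows "\<exists>m. measure M {x. m \<le> (idx x :: nat)} < e"
proof -
  define D where "D m = {x. m \<le> idx x}" for m
  have "D m = idx -` {m..} \<inter> space M" for m by (auto simp: D_def)
  then have "D m \<in> sets M" for m using measurable_sets[OF idx, of "{m..}"] by simp
  then have D: "range D \<subseteq> sets M" by auto
  have dec: "decseq D" unfolding D_def decseq_def by auto
  have "x \<notin> D (Suc (idx x))" for x by (simp add: D_def)
  then have "(\<Inter>n. D n) = {}" by (intro equals0I) (metis INT_D UNIV_I)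
  with finite_Lim_measure_decseq[OF D dec] have "(\<lambda>n. measure M (D n)) \<longlonglongrightarrow> 0" by simp
  then have "\<forall>\<^sub>F n in sequentially. measure M (D n) < e" using \<open>e > 0\<close> by (rule order_tendstoD)
  then show ?thesis unfolding D_def by (auto simp: eventually_sequentially)
qed

text \<open>The same role for inclusion conditions: the centres that fail form a union of open balls
  about the points off \<open>W\<close>.\<close>

lemma closed_balls_subset: "closed {x::'a. \<forall>y. dist x y < r \<longrightarrow> y \<in> W}"
proof -
  have "- {x. \<forall>y. dist x y < r \<longrightarrow> y \<in> W} = (\<Union>y\<in>-W. ball y r)"
    by (auto simp: dist_commute)
  then show ?thesis by (simp only: closed_def) (intro open_UN ballI open_ball)
qed

lemma index_sets:
  assumes "idx \<in> M \<rightarrow>\<^sub>M count_space UNIV"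
  shows "{x. idx x = m} \<in> sets M"
proof -
  have "{x. idx x = m} = idx -` {m} \<inter> space M" by auto
  then show ?thesis using measurable_sets[OF assms, of "{m}"] by simp
qed

text \<open>At a cost of \<open>\<eta>\<close> in measure only finitely many index values are kept,
  and their level sets in \<open>\<Omega>\<close> are replaced by closed subsets. Each point then
  has a ball inside \<open>\<Omega>\<close> that misses the other subsets, and
  \<open>uniform_radius\<close> makes the radius common at the cost of another
  \<open>\<eta>\<close>.\<close>

lemma separated_closed_pieces:
  fixes idx :: "'a \<Rightarrow> nat"
  assumes \<Omega>: "open \<Omega>" and idx: "idx \<in> M \<rightarrow>\<^sub>M count_space UNIV" and \<eta>: "\<eta> > 0"
  shows "\<exists>K \<delta> m0. K \<in> sets M \<and> K \<subseteq> \<Omega> \<and> \<delta> > 0 \<and> measure M (\<Omega> - K) < 2 * \<eta> \<and>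
           (\<forall>x\<in>K. idx x < m0) \<and>
           (\<forall>x\<in>K. \<forall>y. dist x y < \<delta> \<longrightarrow> y \<in> \<Omega> \<and> (y \<in> K \<longrightarrow> idx y = idx x))"
proof -
  have \<Omega>M: "\<Omega> \<in> sets M" using \<Omega> by (rule open_sets)
  obtain m0 where m0: "measure M {x. m0 \<le> idx x} < \<eta> / 2"
    using finitely_many_indices[OF idx, of "\<eta> / 2"] \<eta> by auto
  define A where "A m = \<Omega> \<inter> {x. idx x = m}" for m
  have A: "A m \<in> sets M" for m unfolding A_def using \<Omega>M index_sets[OF idx] by auto
  \<comment> \<open>The \<open>m0\<close> losses add up to at most \<open>\<eta> / 2\<close>; the
    added 1 covers \<open>m0 = 0\<close>.\<close>
  have pos: "\<eta> / (2 * (real m0 + 1)) > 0" using \<eta> by simp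
  have "\<forall>m. \<exists>C. closed C \<and> C \<subseteq> A m \<and> measure M (A m - C) < \<eta> / (2 * (real m0 + 1))"
    using inner_closed_approx[OF A pos] by blast
  then obtain C where C: "\<And>m. closed (C m)" "\<And>m. C m \<subseteq> A m"
    "\<And>m. measure M (A m - C m) < \<eta> / (2 * (real m0 + 1))" by metis
  have CM: "C m \<in> sets M" for m using C(1) by (rule closed_sets)
  define L where "L = (\<Union>m<m0. C m)"
  have LM: "L \<in> sets M" unfolding L_def using CM by auto
  have Lidx: "x \<in> L \<Longrightarrow> x \<in> C (idx x) \<and> idx x < m0 \<and> x \<in> \<Omega>" for x
    using C(2) unfolding L_def A_def by auto
  have tail: "{x. m0 \<le> idx x} \<in> sets M"
  proof -
    have "{x. m0 \<le> idx x} = idx -` {m0..} \<inter> space M" by auto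
    then show ?thesis using measurable_sets[OF idx, of "{m0..}"] by simp
  qed
  have 1: "measure M (\<Omega> - L) < \<eta>"
  proof -
    have "measure M (\<Omega> - L) \<le> measure M ({x. m0 \<le> idx x} \<union> (\<Union>m<m0. A m - C m))"
      using A CM tail by (intro finite_measure_mono) (auto simp: L_def A_def not_le)
    also have "\<dots> \<le> measure M {x. m0 \<le> idx x} + measure M (\<Union>m<m0. A m - C m)"
      using A CM tail by (intro measure_Un_le) auto
    also have "measure M (\<Union>m<m0. A m - C m) \<le> (\<Sum>m<m0. measure M (A m - C m))"
      using A CM by (intro measure_UNION_le) auto
    also have "\<dots> \<le> (\<Sum>m<m0. \<eta> / (2 * (real m0 + 1)))"
      using C(3) by (intro sum_mono) (auto intro: less_imp_le)
    also have "\<dots> \<le> \<eta> / 2" using \<eta> by (simp add: field_simps)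
    finally show ?thesis using m0 by simp
  qed
  define P where "P x \<delta> \<longleftrightarrow> (\<forall>y. dist x y < \<delta> \<longrightarrow> y \<in> \<Omega> - (\<Union>m\<in>{..<m0} - {idx x}. C m))" for x \<delta>
  have ci: "x \<in> C m \<Longrightarrow> idx x = m" for x m using C(2) unfolding A_def by blast
  have ex: "\<exists>r>0. P x r" if "x \<in> L" for x
  proof -
    have "open (\<Omega> - (\<Union>m\<in>{..<m0} - {idx x}. C m))"
      using \<Omega> C(1) by (intro open_Diff closed_UN) auto
    moreover have "x \<in> \<Omega> - (\<Union>m\<in>{..<m0} - {idx x}. C m)"
      using Lidx[OF that] C(2) by (auto simp: A_def)
    ultimately show ?thesis unfolding P_def by (auto simp: open_contains_ball subset_iff)
  qed
  have anti: "P x s" if "P x r" "s \<le> r" for x r s using that unfolding P_def by auto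
  have PM: "{x \<in> L. P x r} \<in> sets M" for r
  proof -
    \<comment> \<open>\<open>P\<close> depends on \<open>x\<close> also through
      \<open>idx x\<close>; on \<open>C n\<close> this index is \<open>n\<close>, which leaves a
      closed condition for each \<open>n\<close>.\<close>
    have "{x \<in> L. P x r} = (\<Union>n<m0. C n \<inter> {x. \<forall>y. dist x y < r \<longrightarrow> y \<in> \<Omega> - (\<Union>m\<in>{..<m0} - {n}. C m)})"
      using ci unfolding L_def P_def by fastforce
    also have "\<dots> \<in> sets M"
      by (intro sets.finite_UN sets.Int CM closed_sets closed_balls_subset) simp
    finally show ?thesis .
  qed
  obtain \<delta> where \<delta>: "\<delta> > 0" "measure M (L - {x \<in> L. P x \<delta>}) < \<eta>"
    using uniform_radius[OF PM LM _ ex \<eta>] anti by blast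
  have "measure M (\<Omega> - {x \<in> L. P x \<delta>}) \<le> measure M ((\<Omega> - L) \<union> (L - {x \<in> L. P x \<delta>}))"
    using \<Omega>M LM PM by (intro finite_measure_mono) auto
  also have "\<dots> \<le> measure M (\<Omega> - L) + measure M (L - {x \<in> L. P x \<delta>})"
    using \<Omega>M LM PM by (intro measure_Un_le) auto
  finally have "measure M (\<Omega> - {x \<in> L. P x \<delta>}) < 2 * \<eta>" using 1 \<delta>(2) by simp
  moreover have "idx y = idx x" if "P x \<delta>" "dist x y < \<delta>" "y \<in> L" for x y
    using that Lidx[of y] unfolding P_def by auto
  moreover have "y \<in> \<Omega>" if "P x \<delta>" "dist x y < \<delta>" for x y
    using that unfolding P_def by auto
  ultimately show ?thesis
    using PM[of \<delta>] Lidx \<delta>(1)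
    by (intro exI[of _ "{x \<in> L. P x \<delta>}"] exI[of _ \<delta>] exI[of _ m0]) auto
qed

section \<open>One sawtooth perturbation\<close>

text \<open>\<open>N dvd \<lceil>t\<rceil>\<close> holds on the falling part of the sawtooth \<open>saw N\<close>; the sets for
\<open>j = 0, \<dots>, N - 1\<close> are disjoint, so one of them is small.\<close>

lemma exists_good_shift:
  fixes a :: "'a \<Rightarrow> real"
  assumes N: "N > 0" and a: "a \<in> borel_measurable M" and K: "K \<in> sets M"
  shows "\<exists>j::nat. {x \<in> K. int N dvd \<lceil>a x + real j\<rceil>} \<in> sets M \<and>
            real N * measure M {x \<in> K. int N dvd \<lceil>a x + real j\<rceil>} \<le> measure M UNIV"
proof -
  define B where "B j = {x \<in> K. int N dvd \<lceil>a x + real j\<rceil>}" for j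
  have BM: "B j \<in> sets M" for j
  proof -
    have "(\<lambda>x. \<lceil>a x + real j\<rceil>) \<in> M \<rightarrow>\<^sub>M count_space UNIV"
      using a by measurable
    from measurable_sets[OF this, of "{z. int N dvd z}"]
    have "(\<lambda>x. \<lceil>a x + real j\<rceil>) -` {z. int N dvd z} \<in> sets M" by simp
    moreover have "B j = K \<inter> (\<lambda>x. \<lceil>a x + real j\<rceil>) -` {z. int N dvd z}"
      by (auto simp: B_def)
    ultimately show ?thesis using K by auto
  qed
  have disj: "disjoint_family_on B {..<N}"
  proof (unfold disjoint_family_on_def, intro ballI impI, rule ccontr)
    fix i j assume ij: "i \<in> {..<N}" "j \<in> {..<N}" "i \<noteq> j" "B i \<inter> B j \<noteq> {}"
    then obtain x where x: "int N dvd \<lceil>a x + real i\<rceil>" "int N dvd \<lceil>a x + real j\<rceil>"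
      by (auto simp: B_def)
    \<comment> \<open>Integer shifts pass through the ceiling, so a common point would make
      \<open>N\<close> divide \<open>i - j\<close>, which is nonzero and below \<open>N\<close> in
      absolute value.\<close>
    have "\<lceil>a x + real i\<rceil> - \<lceil>a x + real j\<rceil> = int i - int j"
      by (metis add_diff_cancel_left ceiling_add_of_int of_int_of_nat_eq)
    with x have d: "int N dvd int i - int j" by (metis dvd_diff)
    have "\<bar>int i - int j\<bar> < int N" using ij by auto
    with d ij(3) show False using zdvd_imp_le[of "int N" "\<bar>int i - int j\<bar>"] by auto
  qed
  show ?thesis using exists_small_of_disjoint[OF N disj BM] BM unfolding B_def by blast
qed

text \<open>\<open>S\<close> is the current sum, the \<open>H m\<close> are the candidates of the
  next scale, and \<open>idx x\<close> names the one wanted at \<open>x\<close>. \<open>N\<close>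
  balances two costs: the falling part takes at most the fraction \<open>1 / N\<close> of the total
  measure, while slopes are multiplied by up to \<open>2 * N\<close>. The quadratic bound off
  \<open>\<Omega>\<close> later yields \<open>Lip = 0\<close> there.\<close>

lemma perturbation_step:
  fixes H :: "nat \<Rightarrow> 'a \<Rightarrow> real" and S :: "'a \<Rightarrow> real" and idx :: "'a \<Rightarrow> nat"
  assumes \<Omega>: "open \<Omega>" and idx: "idx \<in> M \<rightarrow>\<^sub>M count_space UNIV"
    and H: "\<And>m. continuous_on UNIV (H m)" and S: "continuous_on UNIV S"
    and pos: "r > 0" "\<theta> > 0" "\<epsilon> > 0"
    and GS: "\<And>x y. x \<in> G \<Longrightarrow> dist x y < r \<Longrightarrow>
          \<bar>(H (idx x) y - S y) - (H (idx x) x - S x)\<bar> \<le> \<theta> * dist x y"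
    and N: "N > 0" "measure M UNIV < real N * \<eta>"
  shows "\<exists>v G' r'. continuous_on UNIV v \<and> (\<forall>y. \<bar>v y\<bar> \<le> \<epsilon>) \<and>
           (\<forall>x y. x \<notin> \<Omega> \<longrightarrow> \<bar>v y\<bar> \<le> \<epsilon> * (dist x y)\<^sup>2) \<and>
           G' \<in> sets M \<and> G' \<subseteq> \<Omega> \<and> r' > 0 \<and> measure M (\<Omega> - G') < 4 * \<eta> \<and>
           (\<forall>x\<in>G'. \<forall>y. dist x y < r' \<longrightarrow>
              S y + v y - H (idx x) y = S x + v x - H (idx x) x) \<and>
           (\<forall>x\<in>G \<inter> G'. \<forall>y. \<bar>v y - v x\<bar> \<le> 2 * real N * \<theta> * dist x y)"
proof -
  have \<Omega>M: "\<Omega> \<in> sets M" using \<Omega> by (rule open_sets)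
  have "0 < real N * \<eta>" using N(2) measure_nonneg[of M UNIV] by linarith
  then have \<eta>: "\<eta> > 0" using N(1) by (simp add: zero_less_mult_iff)
  obtain K \<delta> m0 where K: "K \<in> sets M" "K \<subseteq> \<Omega>" "measure M (\<Omega> - K) < 2 * \<eta>"
      and Kidx: "\<And>x. x \<in> K \<Longrightarrow> idx x < m0" and \<delta>: "\<delta> > 0"
      and K\<Omega>: "\<And>x y. x \<in> K \<Longrightarrow> dist x y < \<delta> \<Longrightarrow> y \<in> \<Omega>"
      and Ksep: "\<And>x y. x \<in> K \<Longrightarrow> y \<in> K \<Longrightarrow> dist x y < \<delta> \<Longrightarrow> idx y = idx x"
    using separated_closed_pieces[OF \<Omega> idx \<eta>] by blast
  define Km where "Km m = {x \<in> K. idx x = m}" for m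
  have "\<forall>m. \<exists>\<psi>. continuous_on UNIV \<psi> \<and> (\<forall>y. 0 \<le> \<psi> y \<and> \<psi> y \<le> (1::real)) \<and>
           (\<forall>x\<in>Km m. \<forall>y. dist x y < \<delta> / 4 \<longrightarrow> \<psi> y = 1) \<and>
           (\<forall>y. \<psi> y \<noteq> 0 \<longrightarrow> (\<exists>x\<in>Km m. dist x y < \<delta> / 2))"
    using cutoff_near_set[OF \<delta>] by blast
  then obtain \<psi> :: "nat \<Rightarrow> 'a \<Rightarrow> real" where
      \<psi>c: "\<And>m. continuous_on UNIV (\<psi> m)" and \<psi>01: "\<And>m y. 0 \<le> \<psi> m y" "\<And>m y. \<psi> m y \<le> 1"
      and \<psi>1: "\<And>m x y. x \<in> Km m \<Longrightarrow> dist x y < \<delta> / 4 \<Longrightarrow> \<psi> m y = 1"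
      and \<psi>0: "\<And>m y. \<psi> m y \<noteq> 0 \<Longrightarrow> \<exists>x\<in>Km m. dist x y < \<delta> / 2"
    by metis
  \<comment> \<open>Within \<open>\<rho>\<close> of a point of \<open>G \<inter> K\<close> both
    \<open>GS\<close> and the local formula \<open>vloc\<close> below apply.\<close>
  define \<rho> where "\<rho> = min r (\<delta> / 4)"
  \<comment> \<open>The bound \<open>\<epsilon> * \<delta>\<^sup>2 / 4\<close> gives the quadratic decay off \<open>\<Omega>\<close>; the last bound covers the points at
    distance at least \<open>\<rho>\<close> from \<open>x\<close>, where \<open>GS\<close> or the cutoffs give no control.\<close>
  define E where "E = min \<epsilon> (min (\<epsilon> * \<delta>\<^sup>2 / 4) (real N * \<theta> * \<rho>))"
  have \<rho>: "\<rho> > 0" using pos \<delta> by (simp add: \<rho>_def)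
  have E: "E > 0" using pos \<delta> \<rho> N(1) by (simp add: E_def)
  \<comment> \<open>Rescaling the sawtooth by \<open>p\<close> in both directions keeps its slopes
    and makes its height at most \<open>p * N\<close>. With this \<open>p\<close>, \<open>m0\<close>
    such terms add up to at most \<open>E\<close>; the added 1 covers \<open>m0 = 0\<close>.\<close>
  define p where "p = E / (real N * (real m0 + 1))"
  have p: "p > 0" using E N(1) by (simp add: p_def)
  \<comment> \<open>Each point is tested with its own index, so a single shift \<open>j\<close>
    serves all pieces at once.\<close>
  define a where "a x = (H (idx x) x - S x) / p" for x
  have cM: "h \<in> borel_measurable M" if "continuous_on UNIV h" for h :: "'a \<Rightarrow> real"
    using borel_measurable_continuous_onI[OF that] sets_eq_borel measurable_cong_sets by blast
  have "(\<lambda>x. H (idx x) x) \<in> borel_measurable M"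
    by (rule measurable_compose_countable[OF cM[OF H] idx])
  then have aM: "a \<in> borel_measurable M" unfolding a_def using cM[OF S] by measurable
  obtain j :: nat where BM: "{x \<in> K. int N dvd \<lceil>a x + real j\<rceil>} \<in> sets M"
      and Bj: "real N * measure M {x \<in> K. int N dvd \<lceil>a x + real j\<rceil>} \<le> measure M UNIV"
    using exists_good_shift[OF N(1) aM K(1)] by blast
  define B where "B = {x \<in> K. int N dvd \<lceil>a x + real j\<rceil>}"
  have "real N * measure M B < real N * \<eta>" using Bj N(2) by (simp add: B_def)
  then have Bsmall: "measure M B < \<eta>" using N(1) by simp
  define w where "w m y = p * saw N ((H m y - S y) / p + real j)" for m y
  define v where "v y = (\<Sum>m<m0. \<psi> m y * w m y)" for y
  have wc: "continuous_on UNIV (w m)" for m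
    unfolding w_def using p
    by (intro continuous_intros continuous_on_compose2[OF continuous_saw[OF N(1)]] H S) auto
  have vc: "continuous_on UNIV v" unfolding v_def by (intro continuous_intros \<psi>c wc)
  have wb: "\<bar>w m y\<bar> \<le> E / (real m0 + 1)" for m y
  proof -
    have "\<bar>w m y\<bar> \<le> p * real N"
      using saw_bounds[OF N(1), of "(H m y - S y) / p + real j"] p by (simp add: w_def abs_mult)
    then show ?thesis using N(1) by (simp add: p_def)
  qed
  have vb: "\<bar>v y\<bar> \<le> E" for y
  proof -
    have "\<bar>v y\<bar> \<le> (\<Sum>m<m0. \<bar>\<psi> m y * w m y\<bar>)" unfolding v_def by (rule sum_abs)
    also have "\<dots> \<le> (\<Sum>m<m0. E / (real m0 + 1))"
    proof (rule sum_mono)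
      fix m
      show "\<bar>\<psi> m y * w m y\<bar> \<le> E / (real m0 + 1)"
        using mult_mono[OF \<psi>01(2)[of m y] wb[of m y]] \<psi>01(1)[of m y] by (simp add: abs_mult)
    qed
    also have "\<dots> \<le> E" using E by (simp add: field_simps)
    finally show ?thesis .
  qed
  have wlip: "\<bar>w m y - w m x\<bar> \<le> 2 * real N * \<bar>(H m y - S y) - (H m x - S x)\<bar>" for m x y
  proof -
    have "\<bar>w m y - w m x\<bar> = p * \<bar>saw N ((H m y - S y) / p + real j) - saw N ((H m x - S x) / p + real j)\<bar>"
      using p unfolding w_def by (simp add: abs_mult flip: right_diff_distrib)
    also have "\<dots> \<le> p * (2 * real N * \<bar>((H m y - S y) / p + real j) - ((H m x - S x) / p + real j)\<bar>)"
      using p by (intro mult_left_mono saw_lipschitz N(1)) auto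
    also have "((H m y - S y) / p + real j) - ((H m x - S x) / p + real j) = ((H m y - S y) - (H m x - S x)) / p"
      by (simp add: diff_divide_distrib)
    also have "p * (2 * real N * \<bar>((H m y - S y) - (H m x - S x)) / p\<bar>) = 2 * real N * \<bar>(H m y - S y) - (H m x - S x)\<bar>"
      using p by (simp add: abs_divide)
    finally show ?thesis .
  qed
  have vsupp: "\<exists>x\<in>K. dist x y < \<delta> / 2" if "v y \<noteq> 0" for y
  proof -
    obtain m where "\<psi> m y * w m y \<noteq> 0" using \<open>v y \<noteq> 0\<close> unfolding v_def by (meson sum.neutral)
    then show ?thesis using \<psi>0[of m y] by (auto simp: Km_def)
  qed
  \<comment> \<open>Only the cutoff of its own piece is active near \<open>x\<close>: a point
    \<open>z\<close> of another piece with \<open>dist z y < \<delta> / 2\<close> would lie within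
    \<open>\<delta>\<close> of \<open>x\<close>, against \<open>Ksep\<close>.\<close>
  have vloc: "v y = w (idx x) y" if x: "x \<in> K" "dist x y < \<delta> / 4" for x y
  proof -
    have "\<psi> m y = 0" if "m \<noteq> idx x" for m
    proof (rule ccontr)
      assume "\<psi> m y \<noteq> 0"
      then obtain z where z: "z \<in> K" "idx z = m" "dist z y < \<delta> / 2" using \<psi>0 by (auto simp: Km_def)
      have "dist x z < \<delta>" using dist_triangle2[of x z y] x(2) z(3) \<delta> by linarith
      then show False using Ksep[OF x(1) z(1)] z(2) that by simp
    qed
    then have "v y = (\<Sum>m<m0. if m = idx x then \<psi> m y * w m y else 0)"
      unfolding v_def by (intro sum.cong) auto
    also have "\<dots> = \<psi> (idx x) y * w (idx x) y" using Kidx[OF x(1)] by simp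
    also have "\<dots> = w (idx x) y" using \<psi>1[of x "idx x" y] x by (simp add: Km_def)
    finally show ?thesis .
  qed
  \<comment> \<open>\<open>x\<close> is at distance at least \<open>\<delta>\<close> from
    \<open>K\<close>, but \<open>v\<close> is supported within \<open>\<delta> / 2\<close> of
    \<open>K\<close>; so \<open>v y\<close> can be nonzero only if \<open>dist x y\<close> is at
    least \<open>\<delta> / 2\<close>.\<close>
  have vout: "\<bar>v y\<bar> \<le> \<epsilon> * (dist x y)\<^sup>2" if x: "x \<notin> \<Omega>" for x y
  proof (cases "v y = 0")
    case True
    then show ?thesis using pos by simp
  next
    case False
    then obtain z where z: "z \<in> K" "dist z y < \<delta> / 2" using vsupp by blast
    have "\<delta> \<le> dist z x" using K\<Omega>[OF z(1), of x] x by (meson not_le)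
    then have "\<delta> / 2 \<le> dist x y" using dist_triangle2[of z x y] z(2) by linarith
    then have "(\<delta> / 2)\<^sup>2 \<le> (dist x y)\<^sup>2" using \<delta> by (intro power_mono) auto
    then have "\<epsilon> * (\<delta> / 2)\<^sup>2 \<le> \<epsilon> * (dist x y)\<^sup>2" using pos by (intro mult_left_mono) auto
    moreover have "\<bar>v y\<bar> \<le> \<epsilon> * (\<delta> / 2)\<^sup>2" using vb[of y] by (simp add: E_def power_divide)
    ultimately show ?thesis by simp
  qed
  define R where "R x s \<longleftrightarrow> (\<forall>y. dist x y < s \<longrightarrow>
      S y + v y - H (idx x) y = S x + v x - H (idx x) x)" for x s
  have DM: "K - B \<in> sets M" using K BM by (auto simp: B_def)
  \<comment> \<open>The index varies with \<open>x\<close>, so the set is split by index; for a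
    fixed index the condition is closed.\<close>
  have RM: "{x \<in> K - B. R x s} \<in> sets M" for s
  proof -
    have "closed {x. \<forall>y. dist x y < s \<longrightarrow> S y + v y - H m y = S x + v x - H m x}" for m
      by (rule closed_const_on_balls) (intro continuous_intros S vc H)
    then have "(\<Union>m. {x. idx x = m} \<inter> {x. \<forall>y. dist x y < s \<longrightarrow> S y + v y - H m y = S x + v x - H m x}) \<in> sets M"
      by (intro sets.countable_UN image_subsetI sets.Int index_sets[OF idx] closed_sets)
    moreover have "{x \<in> K - B. R x s} = (K - B) \<inter>
        (\<Union>m. {x. idx x = m} \<inter> {x. \<forall>y. dist x y < s \<longrightarrow> S y + v y - H m y = S x + v x - H m x})"
      by (auto simp: R_def)
    ultimately show ?thesis using DM by auto
  qed
  have Ranti: "R x s" if "R x r" "s \<le> r" for x r s using that unfolding R_def by auto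
  \<comment> \<open>On the rising part \<open>saw N\<close> is a translation, so near
    \<open>x\<close> the function \<open>v\<close> is \<open>H m - S\<close> plus a
    constant.\<close>
  have Rex: "\<exists>s>0. R x s" if x: "x \<in> K - B" for x
  proof -
    define m where "m = idx x"
    have "\<not> int N dvd \<lceil>a x + real j\<rceil>" using x by (simp add: B_def)
    from saw_locally_translation[OF N(1) this] obtain d where d: "d > 0"
      "\<And>s. \<bar>s - (a x + real j)\<bar> < d \<Longrightarrow> saw N s - s = saw N (a x + real j) - (a x + real j)"
      by blast
    have "continuous_on UNIV (\<lambda>y. (H m y - S y) / p)" using p by (intro continuous_intros H S) auto
    then obtain t where t: "t > 0"
      "\<And>y. dist y x < t \<Longrightarrow> \<bar>(H m y - S y) / p - (H m x - S x) / p\<bar> < d"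
      using d(1) unfolding continuous_on_iff dist_real_def by (metis UNIV_I)
    have "S y + v y - H m y = S x + v x - H m x" if y: "dist x y < min t (\<delta> / 4)" for y
    proof -
      let ?s = "(H m y - S y) / p + real j"
      have "\<bar>?s - (a x + real j)\<bar> < d"
        using t(2)[of y] y by (simp add: a_def m_def dist_commute)
      from d(2)[OF this] have "p * saw N ?s - p * ?s = p * saw N (a x + real j) - p * (a x + real j)"
        by (metis right_diff_distrib)
      moreover have "p * ?s = H m y - S y + p * real j" "p * (a x + real j) = H m x - S x + p * real j"
        using p by (auto simp: a_def m_def distrib_left)
      moreover have "v y = p * saw N ?s" using vloc[of x y] x y by (simp add: m_def w_def)
      moreover have "v x = p * saw N (a x + real j)" using vloc[of x x] x \<delta> by (simp add: m_def w_def a_def)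
      ultimately show ?thesis by simp
    qed
    then have "R x (min t (\<delta> / 4))" unfolding R_def m_def by simp
    moreover have "min t (\<delta> / 4) > 0" using t(1) \<delta> by simp
    ultimately show ?thesis by blast
  qed
  obtain r' where r': "r' > 0" "measure M ((K - B) - {x \<in> K - B. R x r'}) < \<eta>"
    using uniform_radius[OF RM DM _ Rex \<eta>] Ranti by blast
  define G' where "G' = {x \<in> K - B. R x r'}"
  have G'M: "G' \<in> sets M" unfolding G'_def by (rule RM)
  have BM': "B \<in> sets M" using BM by (simp add: B_def)
  \<comment> \<open>The total \<open>4 * \<eta>\<close> is \<open>2 * \<eta>\<close> from the
    separation, \<open>\<eta>\<close> from the falling part and \<open>\<eta>\<close> from the
    uniform radius.\<close>
  have "measure M (\<Omega> - G') \<le> measure M ((\<Omega> - K) \<union> (B \<union> ((K - B) - G')))"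
    using \<Omega>M K BM' DM G'M by (intro finite_measure_mono) auto
  also have "\<dots> \<le> measure M (\<Omega> - K) + measure M (B \<union> ((K - B) - G'))"
    using \<Omega>M K BM' DM G'M by (intro measure_Un_le) auto
  also have "measure M (B \<union> ((K - B) - G')) \<le> measure M B + measure M ((K - B) - G')"
    using BM' DM G'M by (intro measure_Un_le) auto
  finally have small: "measure M (\<Omega> - G') < 4 * \<eta>" using K(3) Bsmall r'(2) by (simp add: G'_def)
  have lip: "\<bar>v y - v x\<bar> \<le> 2 * real N * \<theta> * dist x y" if x: "x \<in> G \<inter> G'" for x y
  proof (cases "dist x y < \<rho>")
    case True
    have xK: "x \<in> K" using x by (simp add: G'_def)
    have "v y = w (idx x) y" "v x = w (idx x) x"
      using vloc[OF xK, of y] vloc[OF xK, of x] True \<delta> by (auto simp: \<rho>_def)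
    then have "\<bar>v y - v x\<bar> \<le> 2 * real N * \<bar>(H (idx x) y - S y) - (H (idx x) x - S x)\<bar>"
      using wlip[of "idx x" y x] by simp
    also have "\<dots> \<le> 2 * real N * (\<theta> * dist x y)"
      using GS[of x y] x True by (intro mult_left_mono) (auto simp: \<rho>_def)
    finally show ?thesis by (simp add: mult.assoc)
  next
    case False
    have "\<bar>v y - v x\<bar> \<le> 2 * E" using vb[of x] vb[of y] by linarith
    also have "\<dots> \<le> 2 * (real N * \<theta> * \<rho>)" by (simp add: E_def)
    also have "\<dots> \<le> 2 * (real N * \<theta> * dist x y)"
      using False pos by (intro mult_left_mono) auto
    finally show ?thesis by (simp add: mult.assoc)
  qed
  have "\<bar>v y\<bar> \<le> \<epsilon>" for y using vb[of y] by (simp add: E_def)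
  moreover have "G' \<subseteq> \<Omega>" using K by (auto simp: G'_def)
  moreover have "\<forall>x\<in>G'. \<forall>y. dist x y < r' \<longrightarrow>
      S y + v y - H (idx x) y = S x + v x - H (idx x) x"
    by (auto simp: G'_def R_def)
  ultimately show ?thesis
    using vc vout G'M r'(1) small lip
    by (intro exI[of _ v] exI[of _ G'] exI[of _ r'] conjI allI ballI impI) (simp_all only:)
qed

section \<open>Iteration of the perturbations and passage to the limit\<close>

text \<open>Stage \<open>n\<close> applies \<open>perturbation_step\<close> with the factor
  \<open>c * 2 ^ n\<close>. Since \<open>close\<close> decays like \<open>4 ^ (- n)\<close>, the
  increments still have slope at most \<open>(1/2) ^ n\<close>, and the measure lost is below
  \<open>(1/2) ^ n\<close>. Both are summable: the first controls the tails of the series, the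
  second feeds Borel-Cantelli.\<close>

lemma exists_function_locally_close:
  fixes H :: "nat \<Rightarrow> nat \<Rightarrow> 'a \<Rightarrow> real" and idx :: "nat \<Rightarrow> 'a \<Rightarrow> nat"
  assumes \<Omega>: "open \<Omega>" and idx: "\<And>n. idx n \<in> M \<rightarrow>\<^sub>M count_space UNIV"
    and H: "\<And>n m. continuous_on UNIV (H n m)" and \<epsilon>: "\<epsilon> > 0"
    and c: "4 * measure M UNIV < real c"
    and close: "\<And>n x y. \<bar>(H (Suc n) (idx (Suc n) x) y - H n (idx n x) y) -
                  (H (Suc n) (idx (Suc n) x) x - H n (idx n x) x)\<bar>
                \<le> dist x y / (2 * real c * 4 ^ n)"
  shows "\<exists>u. continuous_on UNIV u \<and> (\<forall>y. \<bar>u y\<bar> \<le> \<epsilon>) \<and>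
           (\<forall>x y. x \<notin> \<Omega> \<longrightarrow> \<bar>u y\<bar> \<le> \<epsilon> * (dist x y)\<^sup>2) \<and>
           (AE x in M. x \<in> \<Omega> \<longrightarrow> (\<exists>n0. \<forall>n\<ge>n0. \<exists>r>0. \<forall>y. dist x y < r \<longrightarrow>
              \<bar>(u y - H n (idx n x) y) - (u x - H n (idx n x) x)\<bar> \<le> 2 * (1/2) ^ n * dist x y))"
proof -
  have c0: "real c > 0" using c measure_nonneg[of M UNIV] by linarith
  \<comment> \<open>A state \<open>(S, G, r)\<close> is a partial sum, its good set and a uniform
    radius; \<open>P\<close> is the invariant of one stage, \<open>Q\<close> the estimates linking
    consecutive stages.\<close>
  define P :: "nat \<Rightarrow> ('a \<Rightarrow> real) \<times> 'a set \<times> real \<Rightarrow> bool" where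
    "P = (\<lambda>n (S, G, r). continuous_on UNIV S \<and> G \<in> sets M \<and> r > 0 \<and> (n = 0 \<longrightarrow> S = (\<lambda>_. 0)) \<and>
        (\<forall>x\<in>G. \<forall>y. dist x y < r \<longrightarrow> S y - H n (idx n x) y = S x - H n (idx n x) x))"
  define Q :: "nat \<Rightarrow> ('a \<Rightarrow> real) \<times> 'a set \<times> real \<Rightarrow> ('a \<Rightarrow> real) \<times> 'a set \<times> real \<Rightarrow> bool" where
    "Q = (\<lambda>n (S, G, r) (S', G', r'). (\<forall>y. \<bar>S' y - S y\<bar> \<le> \<epsilon> * (1/2) ^ Suc n) \<and>
        (\<forall>x y. x \<notin> \<Omega> \<longrightarrow> \<bar>S' y - S y\<bar> \<le> \<epsilon> * (1/2) ^ Suc n * (dist x y)\<^sup>2) \<and>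
        measure M (\<Omega> - G') < (1/2) ^ n \<and>
        (\<forall>x\<in>G \<inter> G'. \<forall>y. \<bar>(S' y - S y) - (S' x - S x)\<bar> \<le> (1/2) ^ n * dist x y))"
  have "\<exists>f. \<forall>n. P n (f n) \<and> Q n (f n) (f (Suc n))"
  proof (rule dependent_nat_choice)
    \<comment> \<open>With an empty good set the local condition is vacuous, so the zero function
      can start the iteration.\<close>
    show "\<exists>s. P 0 s" by (intro exI[of _ "(\<lambda>_. 0, {}, 1)"]) (simp add: P_def)
  next
    fix s n assume s: "P n s"
    obtain S G r where sd: "s = (S, G, r)" by (metis prod_cases3)
    have S: "continuous_on UNIV S" "r > 0"
      "\<forall>x\<in>G. \<forall>y. dist x y < r \<longrightarrow> S y - H n (idx n x) y = S x - H n (idx n x) x"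
      using s unfolding P_def sd split by blast+
    \<comment> \<open>Chosen so that \<open>N * \<eta>\<close> is \<open>c / 4\<close>, which
      exceeds the total measure, and \<open>2 * N * \<theta>\<close> is
      \<open>(1/2) ^ n\<close>.\<close>
    define N where "N = c * 2 ^ n"
    define \<theta> where "\<theta> = 1 / (2 * real c * 4 ^ n)"
    define \<eta> :: real where "\<eta> = (1/2) ^ n / 4"
    have N: "N > 0" using c0 by (simp add: N_def)
    have "real N * \<eta> = real c / 4" by (simp add: N_def \<eta>_def power_divide)
    then have N\<eta>: "measure M UNIV < real N * \<eta>" using c by simp
    have "(4::real) ^ n = 2 ^ n * 2 ^ n" by (simp flip: power_mult_distrib)
    then have N\<theta>: "2 * real N * \<theta> = (1/2) ^ n"
      using c0 by (simp add: N_def \<theta>_def power_divide)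
    have \<theta>: "\<theta> > 0" using c0 by (simp add: \<theta>_def)
    have e: "\<epsilon> * (1/2) ^ Suc n > 0" using \<epsilon> by simp
    \<comment> \<open>Near a point of \<open>G\<close> the sum \<open>S\<close> is
      \<open>H n (idx n x)\<close> up to a constant, so \<open>close\<close> applies with
      \<open>S\<close> in its place.\<close>
    have GS: "\<bar>(H (Suc n) (idx (Suc n) x) y - S y) - (H (Suc n) (idx (Suc n) x) x - S x)\<bar>
        \<le> \<theta> * dist x y" if "x \<in> G" "dist x y < r" for x y
      using S(3)[rule_format, OF that] close[of n x y] by (simp add: \<theta>_def algebra_simps)
    obtain v G' r' where v: "continuous_on UNIV v" "\<forall>y. \<bar>v y\<bar> \<le> \<epsilon> * (1/2) ^ Suc n"
        "\<forall>x y. x \<notin> \<Omega> \<longrightarrow> \<bar>v y\<bar> \<le> \<epsilon> * (1/2) ^ Suc n * (dist x y)\<^sup>2"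
        "G' \<in> sets M" "r' > 0" "measure M (\<Omega> - G') < 4 * \<eta>"
        "\<forall>x\<in>G'. \<forall>y. dist x y < r' \<longrightarrow>
           S y + v y - H (Suc n) (idx (Suc n) x) y = S x + v x - H (Suc n) (idx (Suc n) x) x"
        "\<forall>x\<in>G \<inter> G'. \<forall>y. \<bar>v y - v x\<bar> \<le> 2 * real N * \<theta> * dist x y"
      using perturbation_step[where H = "H (Suc n)" and idx = "idx (Suc n)" and G = G and S = S,
          OF \<Omega> idx H S(1) S(2) \<theta> e GS N N\<eta>] by blast
    have "P (Suc n) (\<lambda>y. S y + v y, G', r')" unfolding P_def split
      by (intro conjI continuous_on_add S(1) v(1,4,5,7)) simp
    moreover have "measure M (\<Omega> - G') < (1/2) ^ n" using v(6) by (simp add: \<eta>_def)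
    then have "Q n s (\<lambda>y. S y + v y, G', r')"
      unfolding Q_def sd split add_diff_cancel_left' N\<theta>[symmetric]
      by (intro conjI v(2,3,8))
    ultimately show "\<exists>s'. P (Suc n) s' \<and> Q n s s'" by blast
  qed
  then obtain f where f: "\<And>n. P n (f n)" "\<And>n. Q n (f n) (f (Suc n))" by blast
  define S where "S n = fst (f n)" for n
  define G where "G n = fst (snd (f n))" for n
  define r where "r n = snd (snd (f n))" for n
  define v where "v n y = S (Suc n) y - S n y" for n y
  have Sc: "continuous_on UNIV (S n)" and GM: "G n \<in> sets M" and rpos: "r n > 0"
    and Sloc: "\<And>x y. x \<in> G n \<Longrightarrow> dist x y < r n \<Longrightarrow> S n y - H n (idx n x) y = S n x - H n (idx n x) x"
    for n
    using f(1)[of n] unfolding P_def S_def G_def r_def case_prod_unfold by blast+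
  have S0: "S 0 y = 0" for y using f(1)[of 0] by (simp add: P_def S_def case_prod_unfold)
  have vb: "\<bar>v n y\<bar> \<le> \<epsilon> * (1/2) ^ Suc n"
    and vout: "x \<notin> \<Omega> \<Longrightarrow> \<bar>v n y\<bar> \<le> \<epsilon> * (1/2) ^ Suc n * (dist x y)\<^sup>2"
    and Gm: "measure M (\<Omega> - G (Suc n)) < (1/2) ^ n"
    and vlip: "x \<in> G n \<Longrightarrow> x \<in> G (Suc n) \<Longrightarrow> \<bar>v n y - v n x\<bar> \<le> (1/2) ^ n * dist x y"
    for n x y
    using f(2)[of n] unfolding Q_def S_def G_def v_def case_prod_unfold by blast+
  have geo: "(\<lambda>n. \<epsilon> * (1/2) ^ Suc n) sums \<epsilon>"
    using sums_mult[OF power_half_series, of \<epsilon>] by simp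
  have vsum: "summable (\<lambda>n. v n y)" for y
    by (rule summable_comparison_test'[OF sums_summable[OF geo], of 0]) (use vb in auto)
  have bound: "\<bar>suminf a\<bar> \<le> suminf b"
    if "\<And>n. \<bar>a n\<bar> \<le> b n" "summable b" for a b :: "nat \<Rightarrow> real"
  proof -
    have s: "summable (\<lambda>n. \<bar>a n\<bar>)"
      by (rule summable_comparison_test'[OF that(2), of 0]) (use that in auto)
    have "\<bar>suminf a\<bar> \<le> (\<Sum>n. \<bar>a n\<bar>)" by (rule summable_rabs[OF s])
    also have "\<dots> \<le> suminf b" by (rule suminf_le[OF that(1) s that(2)])
    finally show ?thesis .
  qed
  define u where "u y = (\<Sum>n. v n y)" for y
  have Ssum: "S n y = (\<Sum>i<n. v i y)" for n y
    unfolding v_def by (induction n) (simp_all add: S0)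
  have tail: "u y = (\<Sum>i. v (i + n) y) + S n y" for n y
    unfolding u_def Ssum by (rule suminf_split_initial_segment[OF vsum])
  have "uniform_limit UNIV (\<lambda>n y. \<Sum>i<n. v i y) u sequentially"
    unfolding u_def by (rule Weierstrass_m_test[OF _ sums_summable[OF geo]]) (use vb in simp)
  then have uc: "continuous_on UNIV u"
  proof (rule uniform_limit_theorem[rotated])
    show "\<forall>\<^sub>F n in sequentially. continuous_on UNIV (\<lambda>y. \<Sum>i<n. v i y)"
      unfolding v_def by (intro always_eventually allI continuous_intros Sc)
  qed simp
  have ub: "\<bar>u y\<bar> \<le> \<epsilon>" for y
    using bound[OF vb sums_summable[OF geo]] sums_unique[OF geo] by (simp add: u_def)
  have uout: "\<bar>u y\<bar> \<le> \<epsilon> * (dist x y)\<^sup>2" if "x \<notin> \<Omega>" for x y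
    using bound[OF vout[OF that] sums_summable[OF sums_mult2[OF geo]], of y]
      sums_unique[OF sums_mult2[OF geo, of "(dist x y)\<^sup>2"]] by (simp add: u_def)
  have sumG: "summable (\<lambda>n. measure M (\<Omega> - G (Suc n)))"
    by (rule summable_comparison_test'[OF summable_geometric[of "1/2::real"], of 0])
      (use Gm in \<open>auto intro: less_imp_le\<close>)
  have "AE x in M. \<forall>\<^sub>F n in sequentially. x \<in> space M - (\<Omega> - G (Suc n))"
    by (rule borel_cantelli_AE1[OF _ _ sumG]) (use GM open_sets[OF \<Omega>] in \<open>auto simp: less_top[symmetric]\<close>)
  then have "AE x in M. x \<in> \<Omega> \<longrightarrow> (\<exists>n0. \<forall>n\<ge>n0. \<exists>r>0. \<forall>y. dist x y < r \<longrightarrow>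
              \<bar>(u y - H n (idx n x) y) - (u x - H n (idx n x) x)\<bar> \<le> 2 * (1/2) ^ n * dist x y)"
  proof eventually_elim
    case (elim x)
    show ?case
    proof
      assume "x \<in> \<Omega>"
      with elim obtain k where k: "\<And>n. n \<ge> k \<Longrightarrow> x \<in> G (Suc n)"
        by (auto simp: eventually_sequentially)
      \<comment> \<open>The summable losses concern \<open>G (Suc n)\<close>, hence the shift by
        one.\<close>
      have k': "x \<in> G n" if "n \<ge> Suc k" for n
        using that k[of "n - 1"] by (cases n) auto
      have est: "\<bar>(u y - H n (idx n x) y) - (u x - H n (idx n x) x)\<bar> \<le> 2 * (1/2) ^ n * dist x y"
        if n: "n \<ge> Suc k" and y: "dist x y < r n" for n y
      proof -
        have geo': "(\<lambda>i. (1/2) ^ (i + n) * dist x y) sums (2 * (1/2) ^ n * dist x y)"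
          using sums_mult2[OF sums_mult2[OF geometric_sums[of "1/2::real"], of "(1/2) ^ n"], of "dist x y"]
          by (simp add: power_add mult.commute)
        \<comment> \<open>Near \<open>x\<close> the function \<open>S n - H n (idx n x)\<close> is
          constant, so only the tail of the series remains. The slope bounds \<open>vlip\<close>
          hold for all \<open>y\<close>, not just within the radii \<open>r i\<close>, which may
          tend to 0; this allows them to be summed.\<close>
        have "(u y - H n (idx n x) y) - (u x - H n (idx n x) x) =
            (\<Sum>i. v (i + n) y) - (\<Sum>i. v (i + n) x)"
          using Sloc[OF k'[OF n] y] tail[of y n] tail[of x n] by simp
        also have "\<dots> = (\<Sum>i. v (i + n) y - v (i + n) x)"
          by (intro suminf_diff summable_ignore_initial_segment vsum)
        also have "\<bar>\<dots>\<bar> \<le> (\<Sum>i. (1/2) ^ (i + n) * dist x y)"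
          using n by (intro bound vlip k' sums_summable[OF geo']) auto
        also have "\<dots> = 2 * (1/2) ^ n * dist x y" using sums_unique[OF geo'] by simp
        finally show ?thesis .
      qed
      show "\<exists>n0. \<forall>n\<ge>n0. \<exists>r>0. \<forall>y. dist x y < r \<longrightarrow>
              \<bar>(u y - H n (idx n x) y) - (u x - H n (idx n x) x)\<bar> \<le> 2 * (1/2) ^ n * dist x y"
        using est rpos by (intro exI[of _ "Suc k"] allI impI) blast
    qed
  qed
  with uc ub uout show ?thesis by blast
qed

section \<open>Rounding the prescribed differential to countably many values\<close>

lemma measurable_tuple_count_space:
  fixes h :: "nat \<Rightarrow> 'a \<Rightarrow> int"
  assumes [measurable]: "\<And>i. h i \<in> M \<rightarrow>\<^sub>M count_space UNIV"
  shows "(\<lambda>x. map (\<lambda>i. h i x) [0..<k]) \<in> M \<rightarrow>\<^sub>M count_space UNIV"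
proof -
  have "(\<lambda>x. map (\<lambda>i. h i x) [0..<k]) -` {l} \<inter> space M \<in> sets M" for l
  proof -
    have "{x \<in> space M. length l = k \<and> (\<forall>i\<in>{..<k}. h i x = l ! i)} \<in> sets M" by measurable
    moreover have "map (\<lambda>i. h i x) [0..<k] = l \<longleftrightarrow> length l = k \<and> (\<forall>i\<in>{..<k}. h i x = l ! i)" for x
      unfolding list_eq_iff_nth_eq by auto
    then have "(\<lambda>x. map (\<lambda>i. h i x) [0..<k]) -` {l} \<inter> space M =
        {x \<in> space M. length l = k \<and> (\<forall>i\<in>{..<k}. h i x = l ! i)}"
      by (simp add: vimage_def)
    ultimately show ?thesis by simp
  qed
  then show ?thesis by (subst measurable_count_space_eq2_countable) auto
qed

text \<open>The coefficients \<open>F x i\<close> are rounded down to multiples of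
  \<open>1 / s n (c x)\<close>. At each scale only countably many combinations of chart coordinates
  then occur; numbered, they are the candidates \<open>H n m\<close> for
  \<open>exists_function_locally_close\<close>.\<close>

lemma exists_function_with_prescribed_differential:
  fixes c :: "'a \<Rightarrow> nat" and k :: "nat \<Rightarrow> nat" and \<phi> :: "nat \<Rightarrow> 'a \<Rightarrow> nat \<Rightarrow> real"
    and F :: "'a \<Rightarrow> nat \<Rightarrow> real"
  assumes \<Omega>: "open \<Omega>" and c: "c \<in> M \<rightarrow>\<^sub>M count_space UNIV"
    and \<phi>: "\<And>j. \<exists>L. \<forall>i<k j. \<forall>x y. \<bar>\<phi> j x i - \<phi> j y i\<bar> \<le> L * dist x y"
    and F: "\<And>i. (\<lambda>x. F x i) \<in> borel_measurable M" and \<epsilon>: "\<epsilon> > 0"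
  shows "\<exists>u. continuous_on UNIV u \<and> (\<forall>y. \<bar>u y\<bar> \<le> \<epsilon>) \<and>
           (\<forall>x y. x \<notin> \<Omega> \<longrightarrow> \<bar>u y\<bar> \<le> \<epsilon> * (dist x y)\<^sup>2) \<and>
           (AE x in M. x \<in> \<Omega> \<longrightarrow> chart_differentiable (\<phi> (c x)) (k (c x)) u x (F x))"
proof -
  have "\<exists>L\<ge>0. \<forall>i<k j. \<forall>x y. \<bar>\<phi> j x i - \<phi> j y i\<bar> \<le> L * dist x y" for j
  proof -
    obtain L where L: "\<And>i x y. i < k j \<Longrightarrow> \<bar>\<phi> j x i - \<phi> j y i\<bar> \<le> L * dist x y" using \<phi> by blast
    have "\<bar>\<phi> j x i - \<phi> j y i\<bar> \<le> max L 0 * dist x y" if "i < k j" for i x y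
      using L[OF that, of x y] mult_right_mono[of L "max L 0" "dist x y"] by simp
    then show ?thesis by (intro exI[of _ "max L 0"]) simp
  qed
  then obtain L where L0: "\<And>j. L j \<ge> 0"
      and L: "\<And>j i x y. i < k j \<Longrightarrow> \<bar>\<phi> j x i - \<phi> j y i\<bar> \<le> L j * dist x y"
    by metis
  obtain C :: nat where C: "4 * measure M UNIV < real C" using reals_Archimedean2 by blast
  have C1: "real C \<ge> 1" using C measure_nonneg[of M UNIV] by (cases C) auto
  \<comment> \<open>The last factor absorbs the sum over the coordinates, so rounding costs a
    Lipschitz error of at most \<open>1 / (4 * C * 4 ^ n)\<close>, half of the bound in
    \<open>close\<close>; the added 1 keeps \<open>s\<close> positive.\<close>
  define s where "s n j = 4 ^ n * (4 * real C) * (real (k j) * L j + 1)" for n j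
  have spos: "s n j > 0" for n j
    using C1 L0[of j] by (simp add: s_def add_nonneg_pos)
  have snz: "s n j \<noteq> 0" for n j using spos[of n j] by simp
  define q where "q n x i = of_int \<lfloor>F x i * s n (c x)\<rfloor> / s n (c x)" for n x i
  define enc where "enc n x = (c x, map (\<lambda>i. \<lfloor>F x i * s n (c x)\<rfloor>) [0..<k (c x)])" for n x
  define idx where "idx n x = to_nat (enc n x)" for n x
  \<comment> \<open>Decodes a number into a chart and integer coefficients. Lists shorter than
    \<open>k j\<close> cause no trouble: \<open>l ! i\<close> is still some fixed integer.\<close>
  define H where "H n m y = (case from_nat m of (j, l) \<Rightarrow>
      \<Sum>i<k j. of_int (l ! i :: int) / s n j * \<phi> j y i)" for n m y
  have Hidx: "H n (idx n x) y = (\<Sum>i<k (c x). q n x i * \<phi> (c x) y i)" for n x y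
    by (simp add: H_def idx_def enc_def q_def)
  have idxM: "idx n \<in> M \<rightarrow>\<^sub>M count_space UNIV" for n
  proof -
    have "(\<lambda>x. \<lfloor>F x i * s n j\<rfloor>) \<in> M \<rightarrow>\<^sub>M count_space UNIV" for i j
      using F by measurable
    then have "(\<lambda>x. map (\<lambda>i. \<lfloor>F x i * s n j\<rfloor>) [0..<k j]) \<in> M \<rightarrow>\<^sub>M count_space UNIV" for j
      by (rule measurable_tuple_count_space)
    then have "(\<lambda>x. to_nat (j, map (\<lambda>i. \<lfloor>F x i * s n j\<rfloor>) [0..<k j])) \<in> M \<rightarrow>\<^sub>M count_space UNIV" for j
      by (rule measurable_compose[of _ _ _ "\<lambda>l. to_nat (j, l)"]) simp
    from measurable_compose_countable[OF this c] show ?thesis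
      unfolding idx_def enc_def .
  qed
  have \<phi>c: "continuous_on UNIV (\<lambda>y. \<phi> j y i)" if "i < k j" for i j
  proof -
    have "(L j)-lipschitz_on UNIV (\<lambda>y. \<phi> j y i)"
      by (rule lipschitz_onI) (use L[OF that] L0 in \<open>auto simp: dist_real_def\<close>)
    then show ?thesis by (rule lipschitz_on_continuous_on)
  qed
  have Hc: "continuous_on UNIV (H n m)" for n m
    unfolding H_def by (cases "from_nat m :: nat \<times> int list") (auto intro!: continuous_intros \<phi>c simp: snz)
  \<comment> \<open>The combination with the exact coefficients at \<open>x\<close>, frozen while
    \<open>y\<close> varies.\<close>
  define V where "V x y = vinner (k (c x)) (F x) (\<phi> (c x) y)" for x y
  have err: "\<bar>(V x y - H n (idx n x) y) - (V x x - H n (idx n x) x)\<bar> \<le> dist x y / (4 * real C * 4 ^ n)"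
    for n x y
  proof -
    let ?j = "c x"
    have qe: "\<bar>F x i - q n x i\<bar> \<le> 1 / s n ?j" for i
    proof -
      have "F x i - q n x i = (F x i * s n ?j - of_int \<lfloor>F x i * s n ?j\<rfloor>) / s n ?j"
        using spos[of n ?j] by (simp add: q_def diff_divide_distrib)
      moreover have "\<bar>F x i * s n ?j - of_int \<lfloor>F x i * s n ?j\<rfloor>\<bar> \<le> 1" by linarith
      ultimately show ?thesis using spos[of n ?j] by (simp add: divide_right_mono)
    qed
    have "(V x y - H n (idx n x) y) - (V x x - H n (idx n x) x) =
        (\<Sum>i<k ?j. (F x i - q n x i) * (\<phi> ?j y i - \<phi> ?j x i))"
      unfolding V_def vinner_def Hidx sum_subtractf[symmetric] by (intro sum.cong) (auto simp: algebra_simps)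
    also have "\<bar>\<dots>\<bar> \<le> (\<Sum>i<k ?j. \<bar>(F x i - q n x i) * (\<phi> ?j y i - \<phi> ?j x i)\<bar>)" by (rule sum_abs)
    also have "\<dots> \<le> (\<Sum>i<k ?j. 1 / s n ?j * (L ?j * dist x y))"
      unfolding abs_mult using L[of _ ?j y x] spos[of n ?j]
      by (intro sum_mono mult_mono qe) (auto simp: dist_commute)
    also have "\<dots> = (real (k ?j) * L ?j) * (dist x y / s n ?j)" by simp
    also have "\<dots> \<le> (real (k ?j) * L ?j + 1) * (dist x y / s n ?j)"
      using spos[of n ?j] by (intro mult_right_mono) auto
    also have "\<dots> = dist x y / (4 * real C * 4 ^ n)"
      using L0[of ?j] C1 spos[of n ?j] by (simp add: s_def field_simps)
    finally show ?thesis .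
  qed
  have close: "\<bar>(H (Suc n) (idx (Suc n) x) y - H n (idx n x) y) -
                  (H (Suc n) (idx (Suc n) x) x - H n (idx n x) x)\<bar>
                \<le> dist x y / (2 * real C * 4 ^ n)" for n x y
  proof -
    have "dist x y / (4 * real C * 4 ^ Suc n) \<le> dist x y / (4 * real C * 4 ^ n)"
      using C1 by (intro divide_left_mono) auto
    moreover have "dist x y / (4 * real C * 4 ^ n) + dist x y / (4 * real C * 4 ^ n) = dist x y / (2 * real C * 4 ^ n)"
      using C1 by (simp add: field_simps)
    ultimately show ?thesis using err[where n=n and x=x and y=y] err[where n="Suc n" and x=x and y=y] by linarith
  qed
  obtain u where u: "continuous_on UNIV u" "\<forall>y. \<bar>u y\<bar> \<le> \<epsilon>"
    "\<forall>x y. x \<notin> \<Omega> \<longrightarrow> \<bar>u y\<bar> \<le> \<epsilon> * (dist x y)\<^sup>2"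
    "AE x in M. x \<in> \<Omega> \<longrightarrow> (\<exists>n0. \<forall>n\<ge>n0. \<exists>r>0. \<forall>y. dist x y < r \<longrightarrow>
        \<bar>(u y - H n (idx n x) y) - (u x - H n (idx n x) x)\<bar> \<le> 2 * (1/2) ^ n * dist x y)"
    using exists_function_locally_close[where H = H and idx = idx, OF \<Omega> idxM Hc \<epsilon> C close] by blast
  have "AE x in M. x \<in> \<Omega> \<longrightarrow> chart_differentiable (\<phi> (c x)) (k (c x)) u x (F x)"
    using u(4)
  proof eventually_elim
    case (elim x)
    show ?case
    proof
      assume "x \<in> \<Omega>"
      with elim obtain n0 where n0: "\<And>n. n \<ge> n0 \<Longrightarrow> \<exists>r>0. \<forall>y. dist x y < r \<longrightarrow>
        \<bar>(u y - H n (idx n x) y) - (u x - H n (idx n x) x)\<bar> \<le> 2 * (1/2) ^ n * dist x y" by blast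
      have "Lip (\<lambda>y. u y - V x y) x = 0"
      proof (rule Lip_eq_0I)
        fix e :: real assume e: "e > 0"
        \<comment> \<open>The 3 is 2 from \<open>u\<close> against \<open>H n\<close> plus at most 1
          from \<open>H n\<close> against \<open>V\<close>.\<close>
        have "(\<lambda>n. 3 * (1/2::real) ^ n) \<longlonglongrightarrow> 3 * 0" by (intro tendsto_intros) auto
        then have "\<forall>\<^sub>F n in sequentially. 3 * (1/2::real) ^ n < e"
          using e by (intro order_tendstoD) auto
        moreover have "\<forall>\<^sub>F n in sequentially. n \<ge> n0" by (rule eventually_ge_at_top)
        ultimately have "\<forall>\<^sub>F n in sequentially. 3 * (1/2::real) ^ n < e \<and> n \<ge> n0" by (rule eventually_conj)
        then obtain n where n: "3 * (1/2::real) ^ n < e" "n \<ge> n0"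
          using eventually_happens'[OF sequentially_bot] by blast
        obtain r where r: "r > 0" "\<And>y. dist x y < r \<Longrightarrow>
            \<bar>(u y - H n (idx n x) y) - (u x - H n (idx n x) x)\<bar> \<le> 2 * (1/2) ^ n * dist x y"
          using n0[OF n(2)] by blast
        have "\<bar>(u y - V x y) - (u x - V x x)\<bar> \<le> e * dist x y" if y: "dist x y < r" for y
        proof -
          have "(1::real) * 2 ^ n \<le> 4 * real C * 4 ^ n"
            using C1 by (intro mult_mono power_mono) auto
          then have "dist x y / (4 * real C * 4 ^ n) \<le> dist x y / (1 * 2 ^ n)"
            using C1 by (intro divide_left_mono) auto
          then have "dist x y / (4 * real C * 4 ^ n) \<le> (1/2) ^ n * dist x y"
            by (simp add: power_divide)
          moreover have "3 * (1/2) ^ n * dist x y \<le> e * dist x y"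
            using n(1) by (intro mult_right_mono) auto
          ultimately show ?thesis using r(2)[OF y] err[where n=n and x=x and y=y] by (simp add: mult.assoc abs_le_iff)
        qed
        with r(1) show "\<exists>r>0. \<forall>y. dist x y < r \<longrightarrow> \<bar>(u y - V x y) - (u x - V x x)\<bar> \<le> e * dist x y"
          by blast
      qed
      then show "chart_differentiable (\<phi> (c x)) (k (c x)) u x (F x)"
        by (simp add: chart_differentiable_def V_def)
    qed
  qed
  with u show ?thesis by blast
qed

end

section \<open>Reduction to countably many charts and to a finite measure\<close>

text \<open>Finite partial sums are bounded by the total measure, and a summable family has
  countable support.\<close>

lemma (in finite_measure) countable_nonnull_of_disjoint:
  assumes V: "\<And>j. j \<in> J \<Longrightarrow> V j \<in> sets M" and disj: "disjoint_family_on V J"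
  shows "countable {j \<in> J. measure M (V j) \<noteq> 0}"
proof (rule summable_countable_real, rule nonneg_bdd_above_summable_on)
  show "bdd_above (sum (\<lambda>j. measure M (V j)) ` {F. F \<subseteq> J \<and> finite F})"
  proof (rule bdd_aboveI2)
    fix F assume F: "F \<in> {F. F \<subseteq> J \<and> finite F}"
    then have "(\<Sum>j\<in>F. measure M (V j)) = measure M (\<Union>j\<in>F. V j)"
      using V disj by (intro finite_measure_finite_Union[symmetric])
        (auto intro: disjoint_family_on_mono)
    also have "\<dots> \<le> measure M (space M)" by (rule bounded_measure)
    finally show "(\<Sum>j\<in>F. measure M (V j)) \<le> measure M (space M)" .
  qed
qed simp

text \<open>Index 0 is reserved for the points in no \<open>V j\<close>. On each \<open>V j\<close>
  exactly one \<open>n\<close> satisfies \<open>P n x\<close>, so \<open>LEAST\<close> merely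
  selects it, in a form that \<open>measurable_Least\<close> can handle.\<close>

lemma exists_chart_index:
  fixes V :: "'j \<Rightarrow> 'a set"
  assumes J: "countable J" and V: "\<And>j. j \<in> J \<Longrightarrow> V j \<in> sets M" and disj: "disjoint_family_on V J"
  shows "\<exists>c \<in> M \<rightarrow>\<^sub>M count_space UNIV. (\<forall>j\<in>J. \<forall>x\<in>V j. c x = Suc (to_nat_on J j)) \<and>
           (\<forall>x. x \<notin> (\<Union>j\<in>J. V j) \<longrightarrow> c x = 0)"
proof -
  define P where "P n x \<longleftrightarrow> (if n = 0 then x \<notin> (\<Union>j\<in>J. V j)
      else x \<in> (\<Union>j\<in>{j \<in> J. Suc (to_nat_on J j) = n}. V j))" for n x
  have UM: "(\<Union>j\<in>J'. V j) \<in> sets M" if "J' \<subseteq> J" for J'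
    using that V countable_subset[OF that J] by (intro sets.countable_UN') auto
  have "{x \<in> space M. P n x} \<in> sets M" for n
  proof (cases "n = 0")
    case True
    then have "{x \<in> space M. P n x} = space M - (\<Union>j\<in>J. V j)" by (auto simp: P_def)
    then show ?thesis using UM[of J] by auto
  next
    case False
    then have "{x \<in> space M. P n x} = space M \<inter> (\<Union>j\<in>{j \<in> J. Suc (to_nat_on J j) = n}. V j)"
      by (auto simp: P_def)
    then show ?thesis using UM[of "{j \<in> J. Suc (to_nat_on J j) = n}"] by auto
  qed
  then have "Measurable.pred M (P n)" for n by (simp add: pred_def)
  then have "(\<lambda>x. LEAST n. P n x) \<in> M \<rightarrow>\<^sub>M count_space UNIV" by (rule measurable_Least)
  moreover have "(LEAST n. P n x) = Suc (to_nat_on J j)" if j: "j \<in> J" "x \<in> V j" for j x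
  proof -
    have "P n x \<longleftrightarrow> n = Suc (to_nat_on J j)" for n
    proof -
      have xU: "x \<in> (\<Union>j\<in>J. V j)" using j by blast
      have "n = Suc (to_nat_on J j)" if Pn: "P n x"
      proof -
        obtain j' where j': "j' \<in> J" "Suc (to_nat_on J j') = n" "x \<in> V j'"
          using Pn xU unfolding P_def by (metis (mono_tags, lifting) UN_E mem_Collect_eq)
        have "j' = j"
          using j j' disj unfolding disjoint_family_on_def by (metis IntI empty_iff)
        with j' show ?thesis by simp
      qed
      moreover have "P (Suc (to_nat_on J j)) x"
        using j unfolding P_def by (simp only: nat.distinct if_False) blast
      ultimately show ?thesis by blast
    qed
    then show ?thesis by (simp add: Least_equality)
  qed
  moreover have "(LEAST n. P n x) = 0" if "x \<notin> (\<Union>j\<in>J. V j)" for x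
    using that by (intro Least_equality) (auto simp: P_def)
  ultimately show ?thesis by (intro bexI[of _ "\<lambda>x. LEAST n. P n x"]) auto
qed

lemma abs_coord_diff_le_eucl_dist:
  assumes "i < n"
  shows "\<bar>v i - w i\<bar> \<le> eucl_dist n v w"
proof -
  have "(v i - w i)\<^sup>2 \<le> (\<Sum>i<n. (v i - w i)\<^sup>2)" using assms by (intro member_le_sum) auto
  then show ?thesis unfolding eucl_dist_def by (metis real_sqrt_abs real_sqrt_le_iff)
qed

text \<open>Concentric balls of finite measure exhaust the space, so \<open>M\<close> is
  sigma-finite and there is a strictly positive \<open>h\<close> with finite integral;
  \<open>density M h\<close> has the same null sets as \<open>M\<close>.\<close>

lemma PI_space_finite_equivalent:
  fixes M :: "'a::complete_space measure"
  assumes "PI_space M"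
  shows "\<exists>\<nu>. finite_borel_measure_on_metric \<nu> \<and> (\<forall>P. (AE x in \<nu>. P x) \<longleftrightarrow> (AE x in M. P x))"
proof -
  have MB: "sets M = sets borel" and D: "doubling M" using assms by (auto simp: PI_space_def)
  have sp: "space M = UNIV" using sets_eq_imp_space_eq[OF MB] by simp
  interpret sigma_finite_measure M
  proof
    let ?A = "range (\<lambda>n. ball (undefined::'a) (real (Suc n)))"
    have "(\<Union>n. ball (undefined::'a) (real (Suc n))) = UNIV"
    proof (intro set_eqI iffI UNIV_I)
      fix x :: 'a
      obtain n where "dist undefined x < real n" using reals_Archimedean2 by blast
      then have "x \<in> ball undefined (real (Suc n))" by simp
      then show "x \<in> (\<Union>n. ball (undefined::'a) (real (Suc n)))" by blast
    qed
    moreover have "emeasure M a \<noteq> \<infinity>" if "a \<in> ?A" for a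
    proof -
      obtain n where "a = ball undefined (real (Suc n))" using \<open>a \<in> ?A\<close> by blast
      then have "emeasure M a < \<infinity>"
        using D unfolding doubling_def by (metis of_nat_0_less_iff zero_less_Suc)
      then show ?thesis by simp
    qed
    ultimately show "\<exists>A. countable A \<and> A \<subseteq> sets M \<and> \<Union> A = space M \<and> (\<forall>a\<in>A. emeasure M a \<noteq> \<infinity>)"
      by (intro exI[of _ ?A] conjI) (auto simp: MB sp)
  qed
  obtain h where h: "h \<in> borel_measurable M" "integral\<^sup>N M h \<noteq> \<infinity>" "\<And>x. 0 < h x"
    using Ex_finite_integrable_function by (auto simp: sp)
  have "finite_measure (density M h)"
    by (rule finite_measureI) (use h in \<open>simp add: emeasure_density cong: nn_integral_cong\<close>)
  then have "finite_borel_measure_on_metric (density M h)"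
    by (intro finite_borel_measure_on_metric.intro finite_borel_measure_on_metric_axioms.intro) (simp_all add: MB)
  moreover have "(AE x in density M h. P x) \<longleftrightarrow> (AE x in M. P x)" for P
    using h by (simp add: AE_density)
  ultimately show ?thesis by blast
qed

section \<open>Assembly of \<open>u\<close> from the non-null charts\<close>

theorem theorem1p8:
  fixes M :: "'a::complete_space measure" and J :: "'j set" and U :: "'j \<Rightarrow> 'a set"
    and k :: "'j \<Rightarrow> nat" and \<phi> :: "'j \<Rightarrow> 'a \<Rightarrow> nat \<Rightarrow> real"
    and \<Omega> :: "'a set" and \<epsilon> :: real and f :: "'j \<Rightarrow> 'a \<Rightarrow> nat \<Rightarrow> real"
  assumes "PI_space M"
    and "meas_diff_structure M J U k \<phi>"
    and "open \<Omega>"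
    and "\<epsilon> > 0"
    and "\<forall>j\<in>J. borel_on (U j \<inter> \<Omega>) (k j) (f j)"
  shows "\<exists>u::'a \<Rightarrow> real. continuous_on UNIV u \<and>
           (AE x in M. \<exists>j\<in>J. x \<in> U j \<and> (\<exists>v. chart_differentiable (\<phi> j) (k j) u x v)) \<and>
           (\<forall>x. \<bar>u x\<bar> \<le> \<epsilon>) \<and> {x. u x \<noteq> 0} \<subseteq> \<Omega> \<and>
           (\<forall>j\<in>J. AE x in M. x \<in> U j \<inter> \<Omega> \<longrightarrow> chart_differentiable (\<phi> j) (k j) u x (f j x)) \<and>
           (\<forall>x. x \<notin> \<Omega> \<longrightarrow> Lip u x = 0)"
proof -
  obtain \<nu> where "finite_borel_measure_on_metric \<nu>"
    and AE_eq: "\<And>P. (AE x in \<nu>. P x) \<longleftrightarrow> (AE x in M. P x)"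
    using PI_space_finite_equivalent[OF assms(1)] by blast
  then interpret \<nu>: finite_borel_measure_on_metric \<nu> by simp
  have MB: "sets M = sets borel" using assms(1) by (simp add: PI_space_def)
  have UM: "\<And>j. j \<in> J \<Longrightarrow> U j \<in> sets (completion M)" and disj: "disjoint_family_on U J"
    and cover: "(\<Union>j\<in>J. U j) = UNIV"
    and Lip\<phi>: "\<And>j. j \<in> J \<Longrightarrow> \<exists>L. \<forall>x y. eucl_dist (k j) (\<phi> j x) (\<phi> j y) \<le> L * dist x y"
    using assms(2) unfolding meas_diff_structure_def by blast+
  \<comment> \<open>The \<open>U j\<close> are measurable only for the completion of
    \<open>M\<close>; \<open>main_part\<close> replaces each by a Borel subset, up to a null
    set.\<close>
  define V where "V j = main_part M (U j)" for j
  have VM: "V j \<in> sets \<nu>" if "j \<in> J" for j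
    using main_part_sets[OF UM[OF that]] unfolding V_def MB \<nu>.sets_eq_borel .
  have VU: "V j \<subseteq> U j" if "j \<in> J" for j
    using main_part_null_part_Un[OF UM[OF that]] unfolding V_def by blast
  have AE_V: "AE x in M. x \<in> U j \<longrightarrow> x \<in> V j" if j: "j \<in> J" for j
  proof -
    obtain N where N: "N \<in> null_sets M" "null_part M (U j) \<subseteq> N"
      using null_part[OF UM[OF j]] by blast
    have "AE x in M. x \<notin> N" by (rule AE_not_in[OF N(1)])
    then show ?thesis
    proof eventually_elim
      case (elim x)
      then show ?case using N(2) main_part_null_part_Un[OF UM[OF j]] unfolding V_def by blast
    qed
  qed
  have disjV: "disjoint_family_on V J"
    using disj VU unfolding disjoint_family_on_def by blast
  \<comment> \<open>Null charts impose no condition almost everywhere, and the remaining ones are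
    countable, so they can be numbered.\<close>
  define J' where "J' = {j \<in> J. measure \<nu> (V j) \<noteq> 0}"
  have J'J: "J' \<subseteq> J" by (auto simp: J'_def)
  have J': "countable J'"
    unfolding J'_def using VM disjV by (rule \<nu>.countable_nonnull_of_disjoint)
  have AE_null: "AE x in M. x \<notin> V j" if "j \<in> J" "j \<notin> J'" for j
  proof -
    have "measure \<nu> (V j) = 0" using that by (simp add: J'_def)
    then have "V j \<in> null_sets \<nu>"
      using VM[OF that(1)] by (simp add: null_sets_def \<nu>.emeasure_eq_measure)
    then show ?thesis using AE_not_in AE_eq by blast
  qed
  obtain c where c: "c \<in> \<nu> \<rightarrow>\<^sub>M count_space UNIV"
      and cV: "\<And>j x. j \<in> J' \<Longrightarrow> x \<in> V j \<Longrightarrow> c x = Suc (to_nat_on J' j)"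
      and c0: "\<And>x. x \<notin> (\<Union>j\<in>J'. V j) \<Longrightarrow> c x = 0"
    using exists_chart_index[OF J', of V \<nu>] VM J'J disjoint_family_on_mono[OF J'J disjV] by blast
  \<comment> \<open>Inverse to the numbering \<open>Suc (to_nat_on J' j)\<close>; the value at
    \<open>n = 0\<close> has no meaning, and the tests on \<open>n\<close> below exclude it.\<close>
  define g where "g n = from_nat_into J' (n - 1)" for n
  have gV: "g (c x) = j" if "j \<in> J'" "x \<in> V j" for j x
    using cV[OF that] from_nat_into_to_nat_on[OF J' that(1)] by (simp add: g_def)
  \<comment> \<open>Uncountably many null charts may cover a set of positive measure; the points outside the
    non-null charts get a chart of dimension 0 with index 0, which forces \<open>Lip u = 0\<close> there.\<close>
  define k' where "k' n = (if n = 0 \<or> g n \<notin> J' then 0 else k (g n))" for n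
  \<comment> \<open>\<open>f j\<close> is Borel only on \<open>U j \<inter> \<Omega>\<close>, so it
    is extended by 0 off the Borel set \<open>D\<close>.\<close>
  define D where "D n i = {x. n \<noteq> 0 \<and> g n \<in> J' \<and> i < k (g n) \<and> x \<in> V (g n) \<inter> \<Omega>}" for n i
  define F where "F x i = (if x \<in> D (c x) i then f (g (c x)) x i else 0)" for x i
  have "(\<lambda>x. if x \<in> D n i then f (g n) x i else 0) \<in> borel_measurable \<nu>" for n i
  proof (cases "n \<noteq> 0 \<and> g n \<in> J' \<and> i < k (g n)")
    case True
    then have gJ: "g n \<in> J" using J'J by blast
    have D: "D n i = V (g n) \<inter> \<Omega>" using True by (auto simp: D_def)
    have "(\<lambda>x. f (g n) x i) \<in> borel_measurable (restrict_space borel (U (g n) \<inter> \<Omega>))"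
      using assms(5) gJ True unfolding borel_on_def by blast
    then have "(\<lambda>x. f (g n) x i) \<in> borel_measurable (restrict_space borel (D n i))"
      by (rule measurable_restrict_mono) (use VU[OF gJ] D in blast)
    moreover have "D n i \<in> sets borel"
      using VM[OF gJ] \<nu>.open_sets[OF assms(3)] unfolding D \<nu>.sets_eq_borel by (rule sets.Int)
    ultimately have "(\<lambda>x. if x \<in> D n i then f (g n) x i else 0) \<in> borel_measurable borel"
      by (subst measurable_restrict_space_iff[symmetric]) auto
    then show ?thesis using measurable_cong_sets[OF \<nu>.sets_eq_borel refl] by blast
  next
    case False
    then have "D n i = {}" by (auto simp: D_def)
    then show ?thesis by simp
  qed
  then have FM: "(\<lambda>x. F x i) \<in> borel_measurable \<nu>" for i
    unfolding F_def by (rule measurable_compose_countable[OF _ c])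
  have FV: "F x i = f j x i" if "j \<in> J'" "x \<in> V j" "x \<in> \<Omega>" "i < k j" for x i j
    using that gV[OF that(1,2)] cV[OF that(1,2)] by (simp add: F_def D_def)
  have Lip': "\<exists>L. \<forall>i<k' n. \<forall>x y. \<bar>\<phi> (g n) x i - \<phi> (g n) y i\<bar> \<le> L * dist x y" for n
  proof (cases "k' n = 0")
    case False
    then have "k' n = k (g n)" "g n \<in> J" using J'J by (auto simp: k'_def split: if_splits)
    then show ?thesis
      using Lip\<phi>[of "g n"] abs_coord_diff_le_eucl_dist order_trans by metis
  qed simp
  obtain u where u: "continuous_on UNIV u" "\<And>y. \<bar>u y\<bar> \<le> \<epsilon>"
    "\<And>x y. x \<notin> \<Omega> \<Longrightarrow> \<bar>u y\<bar> \<le> \<epsilon> * (dist x y)\<^sup>2"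
    "AE x in \<nu>. x \<in> \<Omega> \<longrightarrow> chart_differentiable (\<phi> (g (c x))) (k' (c x)) u x (F x)"
    using \<nu>.exists_function_with_prescribed_differential[where k = k' and \<phi> = "\<lambda>n. \<phi> (g n)" and F = F,
        OF assms(3) c Lip' FM assms(4)] by blast
  have u0: "u x = 0" if "x \<notin> \<Omega>" for x using u(3)[OF that, of x] by simp
  have Lip0: "Lip u x = 0" if x: "x \<notin> \<Omega>" for x
  proof (rule Lip_eq_0I)
    fix e :: real assume e: "e > 0"
    \<comment> \<open>Below the distance \<open>e / \<epsilon>\<close> the quadratic bound is at
      most \<open>e * dist x y\<close>.\<close>
    have "\<bar>u y - u x\<bar> \<le> e * dist x y" if "dist x y < e / \<epsilon>" for y
    proof -
      have "\<bar>u y - u x\<bar> \<le> (\<epsilon> * dist x y) * dist x y"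
        using u(3)[OF x, of y] u0[OF x] by (simp add: power2_eq_square mult.assoc)
      also have "\<dots> \<le> e * dist x y"
        using that assms(4) by (intro mult_right_mono) (auto simp: field_simps)
      finally show ?thesis .
    qed
    then show "\<exists>r>0. \<forall>y. dist x y < r \<longrightarrow> \<bar>u y - u x\<bar> \<le> e * dist x y"
      using e assms(4) by (intro exI[of _ "e / \<epsilon>"]) simp
  qed
  have cd0: "chart_differentiable \<psi> m u x (\<lambda>_. 0)" if "Lip u x = 0" for \<psi> m x
    using that by (simp add: chart_differentiable_def vinner_def)
  have diff_V: "chart_differentiable (\<phi> j) (k j) u x (f j x)"
    if "chart_differentiable (\<phi> (g (c x))) (k' (c x)) u x (F x)" "x \<in> \<Omega>" "j \<in> J'" "x \<in> V j" for j x
  proof -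
    have "k' (c x) = k j" using gV[OF that(3,4)] cV[OF that(3,4)] that(3) by (simp add: k'_def)
    moreover have "vinner (k j) (F x) (\<phi> j y) = vinner (k j) (f j x) (\<phi> j y)" for y
      unfolding vinner_def using FV[OF that(3,4,2)] by simp
    ultimately show ?thesis using that(1) gV[OF that(3,4)] by (simp add: chart_differentiable_def)
  qed
  have "AE x in M. x \<in> \<Omega> \<longrightarrow> chart_differentiable (\<phi> (g (c x))) (k' (c x)) u x (F x)"
    using u(4) AE_eq by blast
  then have ae1: "AE x in M. \<exists>j\<in>J. x \<in> U j \<and> (\<exists>v. chart_differentiable (\<phi> j) (k j) u x v)"
  proof eventually_elim
    case (elim x)
    obtain j where j: "j \<in> J" "x \<in> U j" using cover by blast
    consider "x \<notin> \<Omega>" | "x \<in> \<Omega>" "x \<notin> (\<Union>j\<in>J'. V j)" | i where "x \<in> \<Omega>" "i \<in> J'" "x \<in> V i" by blast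
    then show ?case
    proof cases
      case 1
      then show ?thesis using j cd0[OF Lip0] by blast
    next
      \<comment> \<open>Here \<open>c x = 0\<close>, and differentiability in a chart of dimension 0
        reads \<open>Lip u x = 0\<close>; the zero vector is then a derivative in every
        chart.\<close>
      case 2
      then have "Lip u x = 0"
        using elim c0[OF 2(2)] by (simp add: chart_differentiable_def vinner_def k'_def)
      then show ?thesis using j cd0 by blast
    next
      case 3
      then show ?thesis using diff_V[OF _ 3] elim J'J VU by blast
    qed
  qed
  have ae2: "AE x in M. x \<in> U j \<inter> \<Omega> \<longrightarrow> chart_differentiable (\<phi> j) (k j) u x (f j x)" if j: "j \<in> J" for j
  proof (cases "j \<in> J'")
    case True
    have "AE x in M. x \<in> \<Omega> \<longrightarrow> chart_differentiable (\<phi> (g (c x))) (k' (c x)) u x (F x)"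
      using u(4) AE_eq by blast
    with AE_V[OF j] show ?thesis
      by eventually_elim (use diff_V[OF _ _ True] in blast)
  next
    case False
    from AE_V[OF j] AE_null[OF j False] show ?thesis by eventually_elim blast
  qed
  have "{x. u x \<noteq> 0} \<subseteq> \<Omega>" using u0 by blast
  then show ?thesis using u(1,2) ae1 ae2 Lip0 by (intro exI[of _ u] conjI ballI allI impI)
qed

end
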